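(* For every fixed integer $r\ge 3$ and every $c>0$ there are constants $C,N_0>0$ such that the following holds for every prime $N\ge N_0$. Let $k=k_N:=\bigl\lceil C (N/\log N)^{1/(r-1)}\log N\bigr\rceil$. For every family $\mathcal{B}_{N,k}$ of $k$-element subsets of $\mathbb{Z}/N\mathbb{Z}$ with $|\mathcal{B}_{N,k}|\le N^{c}$ there exists a set $I\subseteq \mathbb{Z}/N\mathbb{Z}$ such that (i) $I$ contains no $r$-AP in $\mathbb{Z}/N\mathbb{Z}$, and (ii) $|I\cap K|\ge 1$ for all $K\in\mathcal{B}_{N,k}$.
   Context: For a prime $N$ and an integer $\ell\ge 2$, a set $\{a_1,\dots,a_\ell\}\subseteq \mathbb{Z}/N\mathbb{Z}$ is an $\ell$-term arithmetic progression ($\ell$-AP) in $\mathbb{Z}/N\mathbb{Z}$ if $|\{a_1,\dots,a_\ell\}|=\ell$ and there is $d\not\equiv 0 \pmod N$ with $a_i\equiv a_1+(i-1)d \pmod N$ for all $i$. *)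

theory Defs
  imports Complex_Main "HOL-Number_Theory.Cong"
begin

text \<open>The ring \<open>\<int>/N\<int>\<close> is represented by the canonical residues \<open>0, \<dots>, N - 1\<close>.\<close>

definition Zmod :: "nat \<Rightarrow> int set" where
  "Zmod N = {0..<int N}"

definition is_AP_mod :: "nat \<Rightarrow> nat \<Rightarrow> int set \<Rightarrow> bool" where
  "is_AP_mod N l A \<longleftrightarrow>
     (\<exists>a :: nat \<Rightarrow> int. A = a ` {1..l} \<and> A \<subseteq> Zmod N \<and> card A = l \<and>
       (\<exists>d :: int. \<not> [d = 0] (mod int N) \<and>
          (\<forall>i\<in>{1..l}. [a i = a 1 + (int i - 1) * d] (mod int N))))"

definition contains_AP_mod :: "nat \<Rightarrow> nat \<Rightarrow> int set \<Rightarrow> bool" where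
  "contains_AP_mod N l I \<longleftrightarrow> (\<exists>A \<subseteq> I. is_AP_mod N l A)"

definition kN :: "nat \<Rightarrow> real \<Rightarrow> nat \<Rightarrow> nat" where
  "kN r C N = nat \<lceil>C * (real N / ln (real N)) powr (1 / (real r - 1)) * ln (real N)\<rceil>"

end

theory Submission
  imports Defs
begin

text \<open>Only three-term progressions matter. The set is \<open>I = X + Y\<close>, where \<open>Y = A g\<^sub>1 + \<dots> + A g\<^sub>D\<close> for a
  fixed Behrend-type progression-free set \<open>A \<subseteq> {0..<L}\<close> with \<open>|A| \<ge> 4 L\<^bsup>1 - \<epsilon>\<^esup>\<close>. The second
  differences \<open>y\<^sub>1 + y\<^sub>3 - 2 y\<^sub>2\<close> of \<open>Y\<close> fill at most \<open>(4 L)\<^sup>D\<close> residues, hardly more than \<open>|Y|\<close>, so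
  few residues are blocked when points are added to \<open>X\<close>. On the other hand the \<open>g\<^sub>j\<close> can be chosen so
  that every \<open>K - Y\<close> has nearly the maximal size \<open>|K| |A|\<^sup>D\<close>. Taking \<open>D\<close> so large that
  \<open>|K| L\<^sup>D\<close> is about \<open>N\<close>, each \<open>K - Y\<close> has size \<open>N\<^bsup>1 - 2\<gamma>\<^esup>\<close> or so, and a greedily chosen \<open>X\<close>
  of size \<open>N\<^bsup>3\<gamma>\<^esup>\<close> meets them all, that is, \<open>X + Y\<close> meets every \<open>K\<close>. This needs only
  \<open>|K| \<ge> N\<^bsup>\<kappa>\<^esup>\<close> with \<open>\<kappa> = 1 / (r - 1)\<close>.\<close>

subsection \<open>Collisions among dilates\<close>

text \<open>Polymorphic because the set is built in \<open>nat\<close> and dilated in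
  \<open>int\<close>. In these types \<open>x = y\<close> already forces
  \<open>z = y\<close>.\<close>

definition ap3_free :: "'a :: semiring_1 set \<Rightarrow> bool" where
  "ap3_free A \<longleftrightarrow> (\<forall>x\<in>A. \<forall>y\<in>A. \<forall>z\<in>A. x + z = 2 * y \<longrightarrow> x = y)"

lemma finite_Zmod [simp]: "finite (Zmod N)"
  by (simp add: Zmod_def)

lemma card_Zmod [simp]: "card (Zmod N) = N"
  by (simp add: Zmod_def)

lemma mod_in_Zmod: "N > 0 \<Longrightarrow> x mod int N \<in> Zmod N"
  by (simp add: Zmod_def)

lemma Zmod_cong_eq: "x \<in> Zmod N \<Longrightarrow> y \<in> Zmod N \<Longrightarrow> [x = y] (mod int N) \<Longrightarrow> x = y"
  by (auto simp: Zmod_def cong_def)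

text \<open>\<open>e\<close> is a unit modulo the prime \<open>N\<close>. The counts of exceptional
  dilations and of blocked residues below all rest on this bound.\<close>

lemma card_linear_cong_le_1:
  assumes "prime N" "\<not> int N dvd e"
  shows "card {x \<in> Zmod N. [e * x = b] (mod int N)} \<le> 1"
proof -
  have "coprime e (int N)"
    using assms prime_imp_coprime[of "int N" e] by (simp add: coprime_commute)
  then have "x = y" if "x \<in> Zmod N" "y \<in> Zmod N" "[e * x = b] (mod int N)" "[e * y = b] (mod int N)" for x y
    using that by (meson Zmod_cong_eq cong_mult_lcancel cong_sym cong_trans)
  then show ?thesis
    by (simp add: card_le_Suc0_iff_eq)
qed

text \<open>The dilate is subtracted because \<open>T\<close> will be \<open>K - Y\<close>, which
  becomes \<open>(K - Y) - A g\<close> when \<open>A g\<close> is added to \<open>Y\<close>.\<close>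

definition minus_dilate :: "nat \<Rightarrow> int set \<Rightarrow> int set \<Rightarrow> int \<Rightarrow> int set" where
  "minus_dilate N T A g = (\<lambda>(t, a). (t - a * g) mod int N) ` (T \<times> A)"

text \<open>A pair of points with distinct second components collides for exactly one dilation factor
  \<open>g\<close>, so on average there are few collisions.\<close>

lemma card_bad_dilates:
  fixes T A :: "int set"
  assumes N: "prime N" and T: "T \<subseteq> Zmod N" and A: "A \<subseteq> Zmod N"
  shows "card {g \<in> Zmod N. 2 * card (minus_dilate N T A g) < card T * card A}
           \<le> 2 * (card T * card A)"
proof -
  define P where "P = T \<times> A"
  define n where "n = card T * card A"
  define f where "f = (\<lambda>g (t, a). (t - a * g) mod int N)"
  define bad where "bad = {g \<in> Zmod N. 2 * card (minus_dilate N T A g) < n}"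
  define coll where "coll = (\<lambda>g. {pq \<in> P \<times> P. fst pq \<noteq> snd pq \<and> f g (fst pq) = f g (snd pq)})"
  have finP: "finite P"
    unfolding P_def using T A finite_subset[OF _ finite_Zmod] by blast
  have cardP: "card P = n"
    by (simp add: P_def n_def card_cartesian_product)
  have finbad: "finite bad" by (simp add: bad_def)
  have many: "n \<le> 2 * card (coll g)" if g: "g \<in> bad" for g
  proof -
    \<comment> \<open>Off the set \<open>Q\<close> of colliding points \<open>f g\<close> is
      injective. For a bad \<open>g\<close> the image has fewer than \<open>n / 2\<close> elements,
      so \<open>Q\<close> has more than \<open>n / 2\<close>, and each of them is the first entry of
      a pair in \<open>coll g\<close>.\<close>
    define Q where "Q = {p \<in> P. \<exists>q \<in> P. p \<noteq> q \<and> f g p = f g q}"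
    have "Q \<subseteq> fst ` coll g"
      by (force simp: Q_def coll_def)
    then have Q: "card Q \<le> card (coll g)"
      using surj_card_le[of "coll g" Q fst] finP by (simp add: coll_def)
    have "inj_on (f g) (P - Q)"
      by (auto simp: inj_on_def Q_def)
    then have "card (P - Q) \<le> card (f g ` P)"
      by (metis Diff_subset card_image card_mono finP finite_imageI image_mono)
    moreover have "f g ` P = minus_dilate N T A g"
      by (simp add: f_def P_def minus_dilate_def)
    moreover have "card P \<le> card (P - Q) + card Q"
      using card_Un_le[of "P - Q" Q] by (simp add: Q_def Un_absorb2)
    ultimately show ?thesis
      using g Q cardP by (simp add: bad_def)
  qed
  have one: "card {g \<in> bad. f g p = f g q} \<le> 1" if "p \<in> P" "q \<in> P" "p \<noteq> q" for p q
  proof -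
    obtain t a t' a' where pq: "p = (t, a)" "q = (t', a')" by fastforce
    have mem: "t \<in> Zmod N" "t' \<in> Zmod N" "a \<in> Zmod N" "a' \<in> Zmod N"
      using that pq T A by (auto simp: P_def)
    have iff: "f g p = f g q \<longleftrightarrow> [(a - a') * g = t - t'] (mod int N)" for g
    proof -
      have "(t - a * g) - (t' - a' * g) = - ((a - a') * g - (t - t'))"
        by (simp add: algebra_simps)
      then show ?thesis
        by (simp only: f_def pq cong_iff_dvd_diff mod_eq_dvd_iff dvd_minus_iff prod.case)
    qed
    show ?thesis
    proof (cases "a = a'")
      \<comment> \<open>Points that share \<open>a\<close> are translated alike, so the distinct
        residues \<open>t\<close> and \<open>t'\<close> stay distinct.\<close>
      case True
      then have "f g p \<noteq> f g q" for g
        using iff that(3) mem pq Zmod_cong_eq[of t N t'] by (auto simp: cong_iff_dvd_diff dvd_diff_commute)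
      then show ?thesis by simp
    next
      case False
      then have "\<not> int N dvd (a - a')"
        using mem Zmod_cong_eq[of a N a'] by (auto simp: cong_iff_dvd_diff)
      then have "card {g \<in> Zmod N. [(a - a') * g = t - t'] (mod int N)} \<le> 1"
        by (rule card_linear_cong_le_1[OF N])
      moreover
      have "{g \<in> bad. f g p = f g q} \<subseteq> {g \<in> Zmod N. [(a - a') * g = t - t'] (mod int N)}"
        by (auto simp: iff bad_def)
      then have "card {g \<in> bad. f g p = f g q} \<le> card {g \<in> Zmod N. [(a - a') * g = t - t'] (mod int N)}"
        by (rule card_mono[rotated]) simp
      ultimately show ?thesis by linarith
    qed
  qed
  \<comment> \<open>Double counting of pairs (\<open>g\<close>, collision under \<open>g\<close>):
    each bad \<open>g\<close> has at least \<open>n / 2\<close> collisions, and each of the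
    \<open>n * n\<close> pairs of points collides for at most one \<open>g\<close>.\<close>
  have "card bad * n = (\<Sum>g\<in>bad. n)" by simp
  also have "\<dots> \<le> (\<Sum>g\<in>bad. 2 * card (coll g))"
    by (intro sum_mono many)
  also have "\<dots> = 2 * (\<Sum>g\<in>bad. card (coll g))"
    by (simp add: sum_distrib_left)
  also have "(\<Sum>g\<in>bad. card (coll g)) =
      (\<Sum>g\<in>bad. \<Sum>pq\<in>P \<times> P. if fst pq \<noteq> snd pq \<and> f g (fst pq) = f g (snd pq) then 1 else 0)"
    using finP by (simp add: coll_def sum.If_cases Int_def)
  also have "\<dots> = (\<Sum>pq\<in>P \<times> P. \<Sum>g\<in>bad. if fst pq \<noteq> snd pq \<and> f g (fst pq) = f g (snd pq) then 1 else 0)"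
    by (rule sum.swap)
  also have "\<dots> \<le> (\<Sum>pq\<in>P \<times> P. 1)"
  proof (rule sum_mono)
    fix pq assume "pq \<in> P \<times> P"
    then show "(\<Sum>g\<in>bad. if fst pq \<noteq> snd pq \<and> f g (fst pq) = f g (snd pq) then 1 else 0) \<le> (1::nat)"
      using one[of "fst pq" "snd pq"] finbad
      by (cases "fst pq = snd pq") (auto simp: sum.If_cases Int_def)
  qed
  also have "\<dots> = n * n"
    by (simp add: card_cartesian_product cardP)
  finally have "card bad * n \<le> 2 * n * n" by simp
  moreover have "card bad = 0" if "n = 0"
    using that by (simp add: bad_def)
  ultimately have "card bad \<le> 2 * n"
    by (cases "n = 0") auto
  then show ?thesis
    by (simp add: bad_def n_def)
qed

subsection \<open>Large progression-free sets of integers\<close>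

text \<open>Numbers whose base-\<open>2m\<close> digits are all below \<open>m\<close> are added without carries, so \<open>q\<close>, the sum
  of the squares of the digits, is strictly convex along progressions of such numbers.\<close>

lemma digit_set_strictly_convex:
  fixes m :: nat
  assumes m: "m > 0"
  shows "\<exists>(S :: nat set) (q :: nat \<Rightarrow> nat). S \<subseteq> {..<(2 * m) ^ d} \<and> card S = m ^ d \<and>
           (\<forall>n\<in>S. q n \<le> d * m\<^sup>2) \<and>
           (\<forall>u\<in>S. \<forall>v\<in>S. \<forall>w\<in>S. u + w = 2 * v \<longrightarrow>
              q u + q w \<ge> 2 * q v \<and> (q u + q w = 2 * q v \<longrightarrow> u = v))"
proof (induction d)
  case 0
  show ?case
    by (rule exI[of _ "{0}"], rule exI[of _ "\<lambda>_. 0"]) auto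
next
  case (Suc d)
  then obtain S q where S: "S \<subseteq> {..<(2 * m) ^ d}" "card S = m ^ d" "\<forall>n\<in>S. q n \<le> d * m\<^sup>2"
    and conv: "\<And>u v w. u \<in> S \<Longrightarrow> v \<in> S \<Longrightarrow> w \<in> S \<Longrightarrow> u + w = 2 * v \<Longrightarrow>
              q u + q w \<ge> 2 * q v \<and> (q u + q w = 2 * q v \<longrightarrow> u = v)"
    by blast
  \<comment> \<open>The number \<open>y\<close> becomes the new lowest digit.\<close>
  define h where "h = (\<lambda>(x, y). 2 * m * x + y)"
  define S' where "S' = h ` (S \<times> {..<m})"
  define q' where "q' = (\<lambda>n. q (n div (2 * m)) + (n mod (2 * m))\<^sup>2)"
  have dm: "h (x, y) div (2 * m) = x" "h (x, y) mod (2 * m) = y" if "y < m" for x y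
    using that m by (simp_all add: h_def)
  have inj: "inj_on h (S \<times> {..<m})"
    by (rule inj_onI) (metis SigmaE dm lessThan_iff)
  have "h (x, y) < (2 * m) ^ Suc d" if "x \<in> S" "y < m" for x y
  proof -
    have "x + 1 \<le> (2 * m) ^ d" using S(1) that by auto
    then have "2 * m * (x + 1) \<le> (2 * m) ^ Suc d"
      by (simp only: power_Suc mult_le_mono2)
    then show ?thesis using that by (simp add: h_def)
  qed
  then have 1: "S' \<subseteq> {..<(2 * m) ^ Suc d}"
    by (auto simp: S'_def)
  have 2: "card S' = m ^ Suc d"
    using S(2) by (simp add: S'_def card_image[OF inj] card_cartesian_product)
  have 3: "q' n \<le> Suc d * m\<^sup>2" if "n \<in> S'" for n
  proof -
    obtain x y where xy: "n = h (x, y)" "x \<in> S" "y < m" using \<open>n \<in> S'\<close> by (auto simp: S'_def)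
    have "q x + y\<^sup>2 \<le> d * m\<^sup>2 + m\<^sup>2"
      using S(3) xy by (intro add_mono power_mono) auto
    then show ?thesis using dm[OF xy(3)] xy(1) by (simp add: q'_def)
  qed
  have 4: "q' u + q' w \<ge> 2 * q' v \<and> (q' u + q' w = 2 * q' v \<longrightarrow> u = v)"
    if "u \<in> S'" "v \<in> S'" "w \<in> S'" "u + w = 2 * v" for u v w
  proof -
    obtain x1 y1 where u: "u = h (x1, y1)" "x1 \<in> S" "y1 < m"
      using \<open>u \<in> S'\<close> by (auto simp: S'_def)
    obtain x2 y2 where v: "v = h (x2, y2)" "x2 \<in> S" "y2 < m"
      using \<open>v \<in> S'\<close> by (auto simp: S'_def)
    obtain x3 y3 where w: "w = h (x3, y3)" "x3 \<in> S" "y3 < m"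
      using \<open>w \<in> S'\<close> by (auto simp: S'_def)
    have eq: "2 * m * (x1 + x3) + (y1 + y3) = 2 * m * (2 * x2) + 2 * y2"
      using that(4) by (simp add: u v w h_def algebra_simps)
    have lt: "y1 + y3 < 2 * m" "2 * y2 < 2 * m" using u v w by auto
    have y: "y1 + y3 = 2 * y2"
    proof -
      have "(y1 + y3) mod (2 * m) = (2 * y2) mod (2 * m)"
        using arg_cong[OF eq, of "\<lambda>n. n mod (2 * m)"] by (simp only: mod_mult_self4)
      then show ?thesis using lt by simp
    qed
    then have x: "x1 + x3 = 2 * x2" using eq m by simp
    \<comment> \<open>With this value of \<open>y3\<close> the convexity defect of the square is
      exactly \<open>2 * (y1 - y2)^2\<close>. The integers permit the subtraction.\<close>
    have y3: "int y3 = 2 * int y2 - int y1" using y by linarith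
    have sqr: "int (y1\<^sup>2 + y3\<^sup>2) = int (2 * y2\<^sup>2) + 2 * (int y1 - int y2)\<^sup>2"
      by (simp only: of_nat_add of_nat_power of_nat_mult y3)
        (simp add: power2_eq_square algebra_simps)
    have "0 \<le> 2 * (int y1 - int y2)\<^sup>2" by simp
    with sqr have "int (2 * y2\<^sup>2) \<le> int (y1\<^sup>2 + y3\<^sup>2)"
      by linarith
    then have sq1: "2 * y2\<^sup>2 \<le> y1\<^sup>2 + y3\<^sup>2"
      by (simp only: of_nat_le_iff)
    have sq2: "y1 = y2" if "y1\<^sup>2 + y3\<^sup>2 = 2 * y2\<^sup>2"
      using sqr unfolding that by simp
    have q': "q' u = q x1 + y1\<^sup>2" "q' v = q x2 + y2\<^sup>2" "q' w = q x3 + y3\<^sup>2"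
      using u v w dm by (simp_all add: q'_def)
    \<comment> \<open>The higher digits and the lowest digit each satisfy a convexity inequality, so
      equality in the sum forces equality in both.\<close>
    have sum_eq_split: "a = a' \<and> b = b'" if "a + b = a' + b'" "a' \<le> a" "b' \<le> b" for a b a' b' :: nat
      using that by presburger
    have qx: "2 * q x2 \<le> q x1 + q x3" "q x1 + q x3 = 2 * q x2 \<Longrightarrow> x1 = x2"
      using conv[OF u(2) v(2) w(2) x] by auto
    have "u = v" if "q' u + q' w = 2 * q' v"
    proof -
      have "q x1 + q x3 + (y1\<^sup>2 + y3\<^sup>2) = 2 * q x2 + 2 * y2\<^sup>2"
        using that by (simp add: q')
      then have "q x1 + q x3 = 2 * q x2" "y1\<^sup>2 + y3\<^sup>2 = 2 * y2\<^sup>2"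
        using sum_eq_split[OF _ qx(1) sq1] by auto
      then show ?thesis using qx(2) sq2 u(1) v(1) by simp
    qed
    moreover have "2 * q' v \<le> q' u + q' w"
      using add_mono[OF qx(1) sq1] by (simp add: q')
    ultimately show ?thesis by blast
  qed
  have q_le: "\<forall>n\<in>S'. q' n \<le> Suc d * m\<^sup>2"
    using 3 by simp
  have q_convex: "\<forall>u\<in>S'. \<forall>v\<in>S'. \<forall>w\<in>S'. u + w = 2 * v \<longrightarrow>
      q' u + q' w \<ge> 2 * q' v \<and> (q' u + q' w = 2 * q' v \<longrightarrow> u = v)"
    by (intro ballI impI 4)
  show ?case
    by (rule exI[of _ S'], rule exI[of _ q'], rule conjI[OF 1 conjI[OF 2 conjI[OF q_le q_convex]]])
qed

text \<open>Behrend's argument: \<open>q\<close> has at most \<open>d * m^2 + 1\<close> values on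
  the digit set, so some level set \<open>F v\<close> is large, and on a level set strict convexity
  leaves only trivial progressions. The factor 4 will pay for the constants 2 and 4 lost in each
  step of the iterated sumset.\<close>

lemma exists_large_ap3_free_set:
  fixes \<epsilon> :: real
  assumes "\<epsilon> > 0"
  shows "\<exists>(L :: nat) (A :: nat set). L \<ge> 1 \<and> A \<subseteq> {..<L} \<and>
           ap3_free A \<and> 4 * real L powr (1 - \<epsilon>) \<le> card A"
proof -
  \<comment> \<open>With \<open>L = (2 * m) ^ d\<close> this makes \<open>L powr \<epsilon>\<close>
    at least \<open>(2 * m) ^ 4\<close>. One factor \<open>m^2\<close> pays for the number of values
    of \<open>q\<close>, another for \<open>4 * 2 ^ d * (d + 1)\<close>, which the choice of
    \<open>m\<close> below exceeds.\<close>
  define d where "d = nat \<lceil>4 / \<epsilon>\<rceil>"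
  have "4 / \<epsilon> \<le> real d"
    unfolding d_def by (rule real_nat_ceiling_ge)
  then have d: "real d * \<epsilon> \<ge> 4"
    using assms by (simp add: field_simps)
  define m where "m = 2 ^ (d + 3) * (d + 1)"
  have m: "m \<ge> 1" by (simp add: m_def Suc_le_eq)
  obtain S :: "nat set" and q where S: "S \<subseteq> {..<(2 * m) ^ d}" "card S = m ^ d" "\<forall>n\<in>S. q n \<le> d * m\<^sup>2"
    and conv: "\<And>u v w. u \<in> S \<Longrightarrow> v \<in> S \<Longrightarrow> w \<in> S \<Longrightarrow> u + w = 2 * v \<Longrightarrow>
              q u + q w \<ge> 2 * q v \<and> (q u + q w = 2 * q v \<longrightarrow> u = v)"
    using digit_set_strictly_convex[of m d] m by force
  have finS: "finite S" using S(1) finite_subset by blast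
  define F where "F = (\<lambda>v. {n \<in> S. q n = v})"
  have "\<exists>v. card S \<le> (d * m\<^sup>2 + 1) * card (F v)"
  proof (rule ccontr)
    assume "\<not> ?thesis"
    then have small: "(d * m\<^sup>2 + 1) * card (F v) < card S" for v by (simp add: not_le)
    have "S = (\<Union>v\<in>{..d * m\<^sup>2}. F v)" using S(3) by (auto simp: F_def)
    then have "card S \<le> (\<Sum>v\<le>d * m\<^sup>2. card (F v))"
      by (metis card_UN_le finite_atMost)
    then have "(d * m\<^sup>2 + 1) * card S \<le> (\<Sum>v\<le>d * m\<^sup>2. (d * m\<^sup>2 + 1) * card (F v))"
      by (metis mult_le_mono2 sum_distrib_left)
    also have "\<dots> < (\<Sum>v\<le>d * m\<^sup>2. card S)"
      by (intro sum_strict_mono small) auto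
    finally show False by simp
  qed
  then obtain v where v: "card S \<le> (d * m\<^sup>2 + 1) * card (F v)" by blast
  have free: "ap3_free (F v)"
    unfolding ap3_free_def
  proof (intro ballI impI)
    fix x y z assume "x \<in> F v" "y \<in> F v" "z \<in> F v" "x + z = 2 * y"
    then show "x = y" using conv[of x y z] by (auto simp: F_def)
  qed
  have "d * m\<^sup>2 + 1 \<le> (d + 1) * m\<^sup>2" using m by (simp add: algebra_simps)
  then have "m ^ d \<le> (d + 1) * m\<^sup>2 * card (F v)"
    using v S(2) mult_le_mono1[of "d * m\<^sup>2 + 1" "(d + 1) * m\<^sup>2" "card (F v)"] by linarith
  then have "real (m ^ d) \<le> real ((d + 1) * m\<^sup>2 * card (F v))"
    by (rule of_nat_mono)
  then have card: "real m ^ d \<le> (real d + 1) * real m ^ 2 * real (card (F v))"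
    by (simp add: algebra_simps)
  have "4 * (2 ^ d * (real d + 1)) \<le> real m" by (simp add: m_def power_add algebra_simps)
  moreover have "real m \<le> real m ^ 2" using m by (simp add: power2_eq_square)
  ultimately have mm: "4 * (2 ^ d * (real d + 1)) \<le> real m ^ 2" by linarith
  have "real ((2 * m) ^ d) = (2 * real m) powr real d"
    using m by (subst powr_realpow) auto
  then have "real ((2 * m) ^ d) powr (1 - \<epsilon>) = (2 * real m) powr (real d * (1 - \<epsilon>))"
    by (simp only: powr_powr)
  also have "\<dots> \<le> (2 * real m) powr (real d - 4)"
    using m d by (intro powr_mono) (auto simp: algebra_simps)
  also have "\<dots> = 2 ^ d * real m ^ d / (16 * real m ^ 4)"
    using m by (simp add: powr_diff powr_realpow power_mult_distrib powr_numeral)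
  finally have "4 * real ((2 * m) ^ d) powr (1 - \<epsilon>) * (16 * real m ^ 4) \<le> 4 * (2 ^ d * real m ^ d)"
    using m by (simp add: field_simps)
  also have "\<dots> \<le> 4 * (2 ^ d * ((real d + 1) * real m ^ 2 * real (card (F v))))"
    using card by simp
  also have "\<dots> = (4 * (2 ^ d * (real d + 1))) * (real m ^ 2 * real (card (F v)))"
    by simp
  also have "\<dots> \<le> real m ^ 2 * (real m ^ 2 * real (card (F v)))"
    using mm by (intro mult_right_mono) auto
  also have "\<dots> = real (card (F v)) * (real m ^ 4)"
    by (simp add: power2_eq_square power4_eq_xxxx)
  also have "\<dots> \<le> real (card (F v)) * (16 * real m ^ 4)"
    by (intro mult_left_mono) auto
  finally have "4 * real ((2 * m) ^ d) powr (1 - \<epsilon>) \<le> card (F v)"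
    using m by (simp add: mult_le_cancel_right)
  moreover have "F v \<subseteq> {..<(2 * m) ^ d}" using S(1) by (auto simp: F_def)
  moreover have "(2 * m) ^ d \<ge> 1" using m by simp
  ultimately show ?thesis using free
    by (intro exI[of _ "(2 * m) ^ d"] exI[of _ "F v"]) blast
qed

subsection \<open>Adding a dilate of a progression-free set\<close>

definition ap3_free_mod :: "nat \<Rightarrow> int set \<Rightarrow> bool" where
  "ap3_free_mod N Y \<longleftrightarrow> (\<forall>x\<in>Y. \<forall>y\<in>Y. \<forall>z\<in>Y. [x + z = 2 * y] (mod int N) \<longrightarrow> x = y)"

text \<open>A progression in \<open>X + Y\<close> yields \<open>x1 + x3 - 2 * x2 + w = 0\<close>
  modulo \<open>N\<close> with \<open>w\<close> in this set, so its size controls how many residues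
  the choice of \<open>X\<close> has to avoid.\<close>

definition second_diffs :: "nat \<Rightarrow> int set \<Rightarrow> int set" where
  "second_diffs N Y = (\<lambda>(x, y, z). (x + z - 2 * y) mod int N) ` (Y \<times> Y \<times> Y)"

text \<open>A point of \<open>X\<close> in this set puts a point of \<open>X + Y\<close> into
  \<open>K\<close>.\<close>

definition diffset :: "nat \<Rightarrow> int set \<Rightarrow> int set \<Rightarrow> int set" where
  "diffset N K Y = (\<lambda>(t, y). (t - y) mod int N) ` (K \<times> Y)"

definition plus_dilate :: "nat \<Rightarrow> int set \<Rightarrow> int set \<Rightarrow> int \<Rightarrow> int set" where
  "plus_dilate N Y A g = (\<lambda>(y, a). (y + a * g) mod int N) ` (Y \<times> A)"

lemma second_diffsI: "x \<in> Y \<Longrightarrow> y \<in> Y \<Longrightarrow> z \<in> Y \<Longrightarrow> (x + z - 2 * y) mod int N \<in> second_diffs N Y"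
  by (force simp: second_diffs_def)

text \<open>Turns the growth of \<open>Y\<close> by a dilate into the situation of
  \<open>card_bad_dilates\<close>, with \<open>T = diffset N K Y\<close>.\<close>

lemma diffset_plus_dilate:
  "diffset N K (plus_dilate N Y A g) = minus_dilate N (diffset N K Y) A g"
proof -
  have "diffset N K (plus_dilate N Y A g) = (\<lambda>(t, y, a). (t - (y + a * g)) mod int N) ` (K \<times> Y \<times> A)"
    unfolding diffset_def plus_dilate_def
    by (auto simp: mod_diff_right_eq image_iff) (metis mod_diff_right_eq)+
  also have "\<dots> = minus_dilate N (diffset N K Y) A g"
    unfolding diffset_def minus_dilate_def
    by (auto simp: mod_diff_left_eq image_iff diff_diff_eq) (metis mod_diff_left_eq diff_diff_eq)+
  finally show ?thesis .
qed

lemma plus_dilate_subset: "N > 0 \<Longrightarrow> plus_dilate N Y A g \<subseteq> Zmod N"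
  by (auto simp: plus_dilate_def mod_in_Zmod)

lemma diffset_subset: "N > 0 \<Longrightarrow> diffset N K Y \<subseteq> Zmod N"
  by (auto simp: diffset_def mod_in_Zmod)

lemma finite_second_diffs: "Y \<subseteq> Zmod N \<Longrightarrow> finite (second_diffs N Y)"
  by (simp add: second_diffs_def finite_subset[OF _ finite_Zmod])

lemma card_diffset_le: "finite K \<Longrightarrow> finite Y \<Longrightarrow> card (diffset N K Y) \<le> card K * card Y"
  unfolding diffset_def by (metis card_cartesian_product card_image_le finite_SigmaI)

lemma card_plus_dilate_le:
  "finite Y \<Longrightarrow> finite A \<Longrightarrow> card (plus_dilate N Y A g) \<le> card Y * card A"
  unfolding plus_dilate_def by (metis card_cartesian_product card_image_le finite_SigmaI)

text \<open>Separates the second difference of \<open>A\<close>, an integer, from that of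
  \<open>Y\<close>, a residue. The size bound and the progression-freeness of \<open>Y + A g\<close>
  both start from this splitting.\<close>

lemma second_diff_plus_dilate:
  fixes g :: int
  shows "((y1 + a1 * g) mod int N + (y3 + a3 * g) mod int N - 2 * ((y2 + a2 * g) mod int N)) mod int N
    = ((y1 + y3 - 2 * y2) mod int N + (a1 + a3 - 2 * a2) * g) mod int N"
proof -
  have "((y1 + a1 * g) mod int N + (y3 + a3 * g) mod int N - 2 * ((y2 + a2 * g) mod int N)) mod int N
    = ((y1 + a1 * g) + (y3 + a3 * g) - 2 * (y2 + a2 * g)) mod int N"
    unfolding cong_def[symmetric] by (intro cong_diff cong_add cong_mult cong_refl) (simp_all add: cong_def)
  also have "(y1 + a1 * g) + (y3 + a3 * g) - 2 * (y2 + a2 * g) =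
      (y1 + y3 - 2 * y2) + (a1 + a3 - 2 * a2) * g"
    by (simp add: algebra_simps)
  finally show ?thesis by (simp only: mod_add_left_eq)
qed

text \<open>Only the interval around \<open>A\<close> enters: the integers
  \<open>a1 + a3 - 2 * a2\<close> lie strictly between \<open>- 2 * L\<close> and
  \<open>2 * L\<close>, which leaves fewer than \<open>4 * L\<close> choices.\<close>

lemma card_second_diffs_plus_dilate:
  assumes Y: "Y \<subseteq> Zmod N" and A: "A \<subseteq> {0..<int L}" and L: "L > 0"
  shows "card (second_diffs N (plus_dilate N Y A g)) \<le> card (second_diffs N Y) * (4 * L)"
proof -
  define V where "V = {- 2 * int L<..<2 * int L}"
  have fin: "finite (second_diffs N Y)" using Y by (rule finite_second_diffs)
  have "second_diffs N (plus_dilate N Y A g) \<subseteq>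
      (\<lambda>(w, v). (w + v * g) mod int N) ` (second_diffs N Y \<times> V)"
  proof
    fix s assume "s \<in> second_diffs N (plus_dilate N Y A g)"
    then obtain y1 a1 y2 a2 y3 a3 where
      mem: "y1 \<in> Y" "y2 \<in> Y" "y3 \<in> Y" "a1 \<in> A" "a2 \<in> A" "a3 \<in> A" and
      s: "s = ((y1 + a1 * g) mod int N + (y3 + a3 * g) mod int N - 2 * ((y2 + a2 * g) mod int N)) mod int N"
      unfolding second_diffs_def plus_dilate_def by auto
    have "a1 \<in> {0..<int L}" "a2 \<in> {0..<int L}" "a3 \<in> {0..<int L}" using mem A by auto
    then have "a1 + a3 - 2 * a2 \<in> V" by (simp add: V_def)
    moreover have "(y1 + y3 - 2 * y2) mod int N \<in> second_diffs N Y"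
      using mem by (intro second_diffsI)
    ultimately show "s \<in> (\<lambda>(w, v). (w + v * g) mod int N) ` (second_diffs N Y \<times> V)"
      unfolding s second_diff_plus_dilate by force
  qed
  then have "card (second_diffs N (plus_dilate N Y A g)) \<le> card (second_diffs N Y \<times> V)"
    by (rule surj_card_le[rotated]) (simp add: fin V_def)
  also have "\<dots> \<le> card (second_diffs N Y) * (4 * L)"
    unfolding card_cartesian_product by (intro mult_le_mono2) (simp add: V_def)
  finally show ?thesis .
qed

text \<open>For these \<open>g\<close> a nonzero second difference of \<open>A\<close>, dilated by
  \<open>g\<close>, might cancel one of \<open>Y\<close>. The value 0 is left out because
  \<open>A\<close> and \<open>Y\<close> can then be treated separately.\<close>

definition bad_dilations :: "nat \<Rightarrow> nat \<Rightarrow> int set \<Rightarrow> int set" where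
  "bad_dilations N L Y = (\<Union>(w, v) \<in> second_diffs N Y \<times> ({- 2 * int L<..<2 * int L} - {0}).
     {g \<in> Zmod N. [v * g = - w] (mod int N)})"

lemma card_bad_dilations:
  assumes "prime N" "2 * L \<le> N" "L > 0" "Y \<subseteq> Zmod N"
  shows "card (bad_dilations N L Y) \<le> card (second_diffs N Y) * (4 * L)"
proof -
  define V where "V = {- 2 * int L<..<2 * int L} - {0}"
  have fin: "finite (second_diffs N Y)" "finite V"
    using assms by (simp_all add: finite_second_diffs V_def)
  have "card (bad_dilations N L Y) \<le>
      (\<Sum>p\<in>second_diffs N Y \<times> V. card (case p of (w, v) \<Rightarrow> {g \<in> Zmod N. [v * g = - w] (mod int N)}))"
    unfolding bad_dilations_def V_def[symmetric] using fin by (intro card_UN_le) simp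
  also have "\<dots> \<le> (\<Sum>p\<in>second_diffs N Y \<times> V. 1)"
  proof (rule sum_mono)
    fix p assume "p \<in> second_diffs N Y \<times> V"
    then obtain w v where p: "p = (w, v)" "v \<in> V" by auto
    \<comment> \<open>Here 0 < |v| < 2 L, which is at most \<open>N\<close>.\<close>
    have "\<not> int N dvd v"
      using p(2) assms(2) by (auto simp: V_def dest: dvd_imp_le_int)
    then show "card (case p of (w, v) \<Rightarrow> {g \<in> Zmod N. [v * g = - w] (mod int N)}) \<le> 1"
      using card_linear_cong_le_1[OF assms(1)] p(1) by simp
  qed
  also have "\<dots> = card (second_diffs N Y) * card V"
    by (simp add: card_cartesian_product)
  also have "\<dots> \<le> card (second_diffs N Y) * (4 * L)"
    using assms(3) by (intro mult_le_mono2) (simp add: V_def card_Diff_subset)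
  finally show ?thesis .
qed

text \<open>A progression in \<open>Y + A g\<close> gives \<open>w + v * g = 0\<close> modulo
  \<open>N\<close>, with second differences \<open>w\<close> of \<open>Y\<close> and
  \<open>v\<close> of \<open>A\<close>. For a \<open>g\<close> that is not bad \<open>v = 0\<close>,
  hence \<open>w = 0\<close>, and the progressions in \<open>A\<close> and in \<open>Y\<close> are
  both trivial.\<close>

lemma ap3_free_mod_plus_dilate:
  assumes Y: "ap3_free_mod N Y" and A: "A \<subseteq> {0..<int L}"
    and A_free: "ap3_free A"
    and g: "g \<in> Zmod N" "g \<notin> bad_dilations N L Y"
  shows "ap3_free_mod N (plus_dilate N Y A g)"
  unfolding ap3_free_mod_def
proof (intro ballI impI)
  fix p q s
  assume mem: "p \<in> plus_dilate N Y A g" "q \<in> plus_dilate N Y A g" "s \<in> plus_dilate N Y A g"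
    and cong: "[p + s = 2 * q] (mod int N)"
  obtain y1 a1 where p: "p = (y1 + a1 * g) mod int N" "y1 \<in> Y" "a1 \<in> A"
    using mem(1) by (auto simp: plus_dilate_def)
  obtain y2 a2 where q: "q = (y2 + a2 * g) mod int N" "y2 \<in> Y" "a2 \<in> A"
    using mem(2) by (auto simp: plus_dilate_def)
  obtain y3 a3 where s: "s = (y3 + a3 * g) mod int N" "y3 \<in> Y" "a3 \<in> A"
    using mem(3) by (auto simp: plus_dilate_def)
  define w where "w = (y1 + y3 - 2 * y2) mod int N"
  define v where "v = a1 + a3 - 2 * a2"
  have "(p + s - 2 * q) mod int N = 0"
    using cong by (simp add: cong_iff_dvd_diff)
  then have 0: "(w + v * g) mod int N = 0"
    unfolding p(1) q(1) s(1) second_diff_plus_dilate w_def v_def .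
  have "w \<in> second_diffs N Y"
    unfolding w_def using p q s by (intro second_diffsI)
  moreover have "v \<in> {- 2 * int L<..<2 * int L}"
  proof -
    have "a1 \<in> {0..<int L}" "a2 \<in> {0..<int L}" "a3 \<in> {0..<int L}" using p q s A by auto
    then show ?thesis by (simp add: v_def)
  qed
  moreover have "[v * g = - w] (mod int N)"
    using 0 by (simp add: cong_iff_dvd_diff add.commute mod_eq_0_iff_dvd)
  ultimately have "v = 0"
    using g unfolding bad_dilations_def by blast
  then have a: "a1 = a2"
    using A_free p q s by (auto simp: v_def ap3_free_def)
  have "[y1 + y3 = 2 * y2] (mod int N)"
    using 0 \<open>v = 0\<close> by (simp add: w_def cong_iff_dvd_diff mod_eq_0_iff_dvd)
  then have "y1 = y2"
    using Y p q s by (auto simp: ap3_free_mod_def)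
  then show "p = q" using a p q by simp
qed

section \<open>Inverse moments of the sizes of difference sets\<close>

text \<open>Let \<open>n = card T * card A\<close>. Outside at most \<open>2 * n\<close> bad
  dilations each term is at most \<open>(2 / n) ^ lam\<close>, and a bad one still leaves at least
  \<open>card T\<close> elements. By \<open>small\<close> the bad contribution is no larger than the
  bound for the good one, hence the factor 2.\<close>

lemma sum_inverse_power_dilates:
  fixes T A :: "int set" and lam :: nat
  assumes N: "prime N" and T: "T \<subseteq> Zmod N" "T \<noteq> {}" and A: "A \<subseteq> Zmod N" "A \<noteq> {}"
    and small: "2 * real (card T * card A) \<le> real N * (2 / real (card A)) ^ lam"
  shows "(\<Sum>g\<in>Zmod N. 1 / real (card (minus_dilate N T A g)) ^ lam)
    \<le> 2 * real N * (2 / real (card A)) ^ lam * (1 / real (card T) ^ lam)"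
proof -
  define n where "n = card T * card A"
  define bad where "bad = {g \<in> Zmod N. 2 * card (minus_dilate N T A g) < n}"
  have fin: "finite T" "finite A" using T A finite_subset[OF _ finite_Zmod] by auto
  have pos: "card T > 0" "card A > 0" using fin T A by (simp_all add: card_gt_0_iff)
  have bad: "card bad \<le> 2 * n"
    unfolding bad_def n_def by (rule card_bad_dilates[OF N T(1) A(1)])
  have low: "card T \<le> card (minus_dilate N T A g)" for g
  proof -
    obtain a where a: "a \<in> A" using A by blast
    have "inj_on (\<lambda>t. (t - a * g) mod int N) T"
    proof (rule inj_onI)
      fix t t' assume t: "t \<in> T" "t' \<in> T" and eq: "(t - a * g) mod int N = (t' - a * g) mod int N"
      have "[t = t'] (mod int N)"
        using eq by (simp add: cong_iff_dvd_diff mod_eq_dvd_iff)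
      then show "t = t'" using t T Zmod_cong_eq by blast
    qed
    moreover have "(\<lambda>t. (t - a * g) mod int N) ` T \<subseteq> minus_dilate N T A g"
      using a by (force simp: minus_dilate_def)
    moreover have "finite (minus_dilate N T A g)"
      using fin by (simp add: minus_dilate_def)
    ultimately show ?thesis by (metis card_image card_mono)
  qed
  have bad_term: "1 / real (card (minus_dilate N T A g)) ^ lam \<le> 1 / real (card T) ^ lam" for g
    using low[of g] pos by (intro divide_left_mono power_mono) auto
  have good_term: "1 / real (card (minus_dilate N T A g)) ^ lam \<le> (2 / real n) ^ lam"
    if "g \<in> Zmod N - bad" for g
  proof -
    have "n \<le> 2 * card (minus_dilate N T A g)" using that by (auto simp: bad_def)
    then have "real n \<le> real (2 * card (minus_dilate N T A g))" by (rule of_nat_mono)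
    then have "1 / real (card (minus_dilate N T A g)) \<le> 2 / real n"
      using pos low[of g] by (simp add: n_def divide_simps)
    then have "(1 / real (card (minus_dilate N T A g))) ^ lam \<le> (2 / real n) ^ lam"
      by (intro power_mono) auto
    then show ?thesis by (simp add: power_one_over)
  qed
  have "(\<Sum>g\<in>Zmod N. 1 / real (card (minus_dilate N T A g)) ^ lam) =
      (\<Sum>g\<in>Zmod N - bad. 1 / real (card (minus_dilate N T A g)) ^ lam) +
      (\<Sum>g\<in>bad. 1 / real (card (minus_dilate N T A g)) ^ lam)"
    by (rule sum.subset_diff) (auto simp: bad_def)
  also have "\<dots> \<le> (\<Sum>g\<in>Zmod N - bad. (2 / real n) ^ lam) + (\<Sum>g\<in>bad. 1 / real (card T) ^ lam)"
    by (intro add_mono sum_mono bad_term good_term)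
  also have "\<dots> \<le> real N * (2 / real n) ^ lam + 2 * real n * (1 / real (card T) ^ lam)"
  proof -
    have "card (Zmod N - bad) \<le> N" using card_mono[of "Zmod N" "Zmod N - bad"] by auto
    moreover have "real (card bad) \<le> 2 * real n" using of_nat_mono[OF bad, where 'a = real] by simp
    ultimately show ?thesis
      unfolding sum_constant by (intro add_mono mult_right_mono) auto
  qed
  also have "real N * (2 / real n) ^ lam = real N * (2 / real (card A)) ^ lam * (1 / real (card T) ^ lam)"
    by (simp add: n_def power_divide power_mult_distrib)
  also have "2 * real n * (1 / real (card T) ^ lam) \<le> real N * (2 / real (card A)) ^ lam * (1 / real (card T) ^ lam)"
    using small by (intro mult_right_mono) (auto simp: n_def)
  finally show ?thesis by simp
qed

text \<open>The mean of the sum over all of \<open>Zmod N\<close> is at most \<open>R\<close>. As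
  \<open>F\<close>, later the set of bad dilations, covers at most half of the residues, some
  \<open>g\<close> outside \<open>F\<close> has a sum of at most \<open>2 * R\<close>.\<close>

lemma exists_good_dilation:
  fixes A Y F :: "int set" and lam :: nat
  assumes N: "prime N" and A: "A \<subseteq> Zmod N" "A \<noteq> {}"
    and T: "\<And>K. K \<in> B \<Longrightarrow> T K \<subseteq> Zmod N \<and> T K \<noteq> {}"
    and small: "\<And>K. K \<in> B \<Longrightarrow> 2 * real (card (T K) * card A) \<le> real N * (2 / real (card A)) ^ lam"
    and F: "2 * card F \<le> N" "F \<subseteq> Zmod N"
  shows "\<exists>g\<in>Zmod N - F. (\<Sum>K\<in>B. 1 / real (card (minus_dilate N (T K) A g)) ^ lam)
    \<le> 4 * (2 / real (card A)) ^ lam * (\<Sum>K\<in>B. 1 / real (card (T K)) ^ lam)"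
proof (rule ccontr)
  define R where "R = 2 * (2 / real (card A)) ^ lam * (\<Sum>K\<in>B. 1 / real (card (T K)) ^ lam)"
  define \<Phi> where "\<Phi> = (\<lambda>g. \<Sum>K\<in>B. 1 / real (card (minus_dilate N (T K) A g)) ^ lam)"
  have \<Phi>_nonneg: "\<Phi> g \<ge> 0" for g by (auto simp: \<Phi>_def intro: sum_nonneg)
  assume "\<not> ?thesis"
  then have large: "\<Phi> g > 2 * R" if "g \<in> Zmod N - F" for g
    using that by (auto simp: R_def \<Phi>_def not_le mult.assoc)
  have R: "R \<ge> 0" by (auto simp: R_def intro!: mult_nonneg_nonneg sum_nonneg)
  have Npos: "N > 0" using N by (simp add: prime_gt_0_nat)
  have cardF: "card (Zmod N - F) = N - card F"
    using F(2) by (simp add: card_Diff_subset finite_subset[OF F(2)])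
  then have half: "real N \<le> 2 * real (card (Zmod N - F))" using F(1) by simp
  then have ne: "Zmod N - F \<noteq> {}" using Npos by (metis card.empty of_nat_0 mult_zero_right of_nat_0_less_iff not_le)
  have "real N * R \<le> 2 * real (card (Zmod N - F)) * R"
    using half R by (rule mult_right_mono)
  also have "\<dots> = (\<Sum>g\<in>Zmod N - F. 2 * R)" by simp
  also have "\<dots> < (\<Sum>g\<in>Zmod N - F. \<Phi> g)"
    using large ne by (intro sum_strict_mono) auto
  also have "\<dots> \<le> (\<Sum>g\<in>Zmod N. \<Phi> g)"
    using \<Phi>_nonneg by (intro sum_mono2) auto
  also have "\<dots> = (\<Sum>K\<in>B. \<Sum>g\<in>Zmod N. 1 / real (card (minus_dilate N (T K) A g)) ^ lam)"
    unfolding \<Phi>_def by (rule sum.swap)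
  also have "\<dots> \<le> (\<Sum>K\<in>B. 2 * real N * (2 / real (card A)) ^ lam * (1 / real (card (T K)) ^ lam))"
    using T small by (intro sum_mono sum_inverse_power_dilates N A) auto
  also have "\<dots> = real N * R"
    by (simp add: R_def sum_distrib_left mult_ac)
  finally show False by simp
qed

text \<open>The sum of \<open>|K - Y|\<^sup>-\<^sup>\<lambda>\<close> controls all \<open>K\<close> at once: a high moment beats the
  number of sets \<open>K\<close>, although for a single \<open>K\<close> a random dilation fails with probability
  only polynomially small.\<close>

lemma exists_iterated_sumset:
  fixes A :: "int set" and B :: "int set set" and lam L D k :: nat
  assumes N: "prime N" and L: "2 * L \<le> N" "L > 0"
    and A: "A \<subseteq> {0..<int L}" "A \<noteq> {}"
    and A_free: "ap3_free A"
    and B: "\<And>K. K \<in> B \<Longrightarrow> K \<subseteq> Zmod N \<and> card K = k" and k: "k > 0"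
    and D: "2 * (4 * L) ^ D \<le> N"
    and small: "2 * real k * real (card A) ^ D \<le> real N * (2 / real (card A)) ^ lam"
    and j: "j \<le> D"
  shows "\<exists>Y. Y \<subseteq> Zmod N \<and> Y \<noteq> {} \<and> ap3_free_mod N Y \<and> card (second_diffs N Y) \<le> (4 * L) ^ j \<and>
    card Y \<le> card A ^ j \<and>
    (\<Sum>K\<in>B. 1 / real (card (diffset N K Y)) ^ lam)
       \<le> (4 * (2 / real (card A)) ^ lam) ^ j * (real (card B) / real k ^ lam)"
  using j
proof (induction j)
  case 0
  have Npos: "N > 0" using N by (simp add: prime_gt_0_nat)
  have "diffset N K {0} = K" if "K \<in> B" for K
  proof -
    have "x mod int N = x" if "x \<in> K" for x using B[OF \<open>K \<in> B\<close>] that by (auto simp: Zmod_def)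
    then show ?thesis by (auto simp: diffset_def image_iff)
  qed
  then have "(\<Sum>K\<in>B. 1 / real (card (diffset N K {0})) ^ lam) = (\<Sum>K\<in>B. 1 / real k ^ lam)"
    using B by (intro sum.cong) auto
  then show ?case
    using Npos by (intro exI[of _ "{0}"]) (auto simp: Zmod_def ap3_free_mod_def second_diffs_def)
next
  case (Suc j)
  then obtain Y where Y: "Y \<subseteq> Zmod N" "Y \<noteq> {}" "ap3_free_mod N Y" "card (second_diffs N Y) \<le> (4 * L) ^ j"
    "card Y \<le> card A ^ j" and
    sum: "(\<Sum>K\<in>B. 1 / real (card (diffset N K Y)) ^ lam)
       \<le> (4 * (2 / real (card A)) ^ lam) ^ j * (real (card B) / real k ^ lam)"
    by (meson Suc_leD)
  have Npos: "N > 0" using N by (simp add: prime_gt_0_nat)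
  have finA: "finite A" and finY: "finite Y"
    using finite_subset[OF A(1)] finite_subset[OF Y(1)] by auto
  have Apos: "card A \<ge> 1" using A finA by (simp add: Suc_le_eq card_gt_0_iff)
  have AZ: "A \<subseteq> Zmod N" using A(1) L by (fastforce simp: Zmod_def)
  define F where "F = bad_dilations N L Y"
  have FZ: "F \<subseteq> Zmod N" by (auto simp: F_def bad_dilations_def)
  have step: "card (second_diffs N Y) * (4 * L) \<le> (4 * L) ^ Suc j"
    using Y(4) by simp
  \<comment> \<open>The hypothesis \<open>D\<close>, made for the final exponent, keeps the bad
    dilations to at most half of the residues at every step.\<close>
  have "(4 * L) ^ Suc j \<le> (4 * L) ^ D"
    using L Suc.prems by (intro power_increasing) auto
  then have F: "2 * card F \<le> N"
    using card_bad_dilations[OF N L Y(1)] step D unfolding F_def by linarith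
  have T: "diffset N K Y \<subseteq> Zmod N \<and> diffset N K Y \<noteq> {}" if "K \<in> B" for K
  proof -
    have "K \<noteq> {}" using B[OF that] k by auto
    then show ?thesis using Y(2) diffset_subset[OF Npos] by (auto simp: diffset_def)
  qed
  have small': "2 * real (card (diffset N K Y) * card A) \<le> real N * (2 / real (card A)) ^ lam"
    if "K \<in> B" for K
  proof -
    \<comment> \<open>As \<open>K - Y\<close> has at most \<open>k * card A ^ j\<close> elements,
      the hypothesis \<open>small\<close> for the final exponent serves every step.\<close>
    have "card (diffset N K Y) \<le> k * card Y"
      using card_diffset_le[of K Y N] B[OF that] finY finite_subset[of K "Zmod N"] by auto
    also have "\<dots> \<le> k * card A ^ j" using Y(5) by simp
    finally have "card (diffset N K Y) * card A \<le> k * card A ^ j * card A"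
      by (rule mult_le_mono1)
    also have "\<dots> = k * card A ^ Suc j" by simp
    also have "\<dots> \<le> k * card A ^ D"
      using Apos Suc.prems by (intro mult_le_mono2 power_increasing) auto
    finally have "real (card (diffset N K Y) * card A) \<le> real (k * card A ^ D)"
      by (rule of_nat_mono)
    then show ?thesis using small by simp
  qed
  obtain g where g: "g \<in> Zmod N - F" and
    \<Phi>: "(\<Sum>K\<in>B. 1 / real (card (minus_dilate N (diffset N K Y) A g)) ^ lam)
    \<le> 4 * (2 / real (card A)) ^ lam * (\<Sum>K\<in>B. 1 / real (card (diffset N K Y)) ^ lam)"
    using exists_good_dilation[where T = "\<lambda>K. diffset N K Y", OF N AZ A(2) T small' F FZ] by auto
  define Y' where "Y' = plus_dilate N Y A g"
  have "Y' \<subseteq> Zmod N" using Npos by (simp add: Y'_def plus_dilate_subset)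
  moreover have "Y' \<noteq> {}" using A(2) Y(2) by (auto simp: Y'_def plus_dilate_def)
  moreover have "ap3_free_mod N Y'"
    unfolding Y'_def using g by (intro ap3_free_mod_plus_dilate[OF Y(3) A(1) A_free]) (auto simp: F_def)
  moreover have "card (second_diffs N Y') \<le> (4 * L) ^ Suc j"
    unfolding Y'_def using card_second_diffs_plus_dilate[OF Y(1) A(1) L(2)] step by (rule le_trans)
  moreover have "card Y' \<le> card A ^ Suc j"
  proof -
    have "card Y' \<le> card Y * card A"
      unfolding Y'_def using finY finA by (rule card_plus_dilate_le)
    also have "\<dots> \<le> card A ^ j * card A" using Y(5) by (rule mult_le_mono1)
    finally show ?thesis by (simp add: mult.commute)
  qed
  moreover have "(\<Sum>K\<in>B. 1 / real (card (diffset N K Y')) ^ lam)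
       \<le> (4 * (2 / real (card A)) ^ lam) ^ Suc j * (real (card B) / real k ^ lam)"
  proof -
    have "(\<Sum>K\<in>B. 1 / real (card (diffset N K Y')) ^ lam)
       \<le> 4 * (2 / real (card A)) ^ lam * (\<Sum>K\<in>B. 1 / real (card (diffset N K Y)) ^ lam)"
      using \<Phi> by (simp add: Y'_def diffset_plus_dilate)
    also have "\<dots> \<le> 4 * (2 / real (card A)) ^ lam *
        ((4 * (2 / real (card A)) ^ lam) ^ j * (real (card B) / real k ^ lam))"
      using sum by (intro mult_left_mono) auto
    finally show ?thesis by (simp only: power_Suc mult.assoc)
  qed
  ultimately show ?case by (intro exI[of _ Y'] conjI)
qed

subsection \<open>Greedy choice of the translates\<close>

text \<open>The residues whose adjunction to \<open>X\<close> creates a solution of \<open>x\<^sub>1 + x\<^sub>3 - 2 x\<^sub>2 + w = 0\<close> with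
  \<open>w \<in> W\<close> and \<open>x\<^sub>1, x\<^sub>2, x\<^sub>3\<close> not all equal; the four congruences come from the
  positions that the new point can occupy.\<close>

definition blocked :: "nat \<Rightarrow> int set \<Rightarrow> int set \<Rightarrow> int set" where
  "blocked N W X = (\<Union>(u, v, w) \<in> X \<times> X \<times> W.
     {x \<in> Zmod N. [1 * x = 2 * u - v - w] (mod int N)} \<union> {x \<in> Zmod N. [2 * x = u + v + w] (mod int N)} \<union>
     ({x \<in> Zmod N. [1 * x = u + w] (mod int N)} \<union> {x \<in> Zmod N. [2 * x = 2 * u - w] (mod int N)}))"

text \<open>Diagonal solutions have \<open>w = 0\<close> modulo \<open>N\<close> and belong to
  progressions inside one translate of \<open>Y\<close>, which the progression-freeness of
  \<open>Y\<close> settles.\<close>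

definition diagonal_only :: "nat \<Rightarrow> int set \<Rightarrow> int set \<Rightarrow> bool" where
  "diagonal_only N W X \<longleftrightarrow> (\<forall>x1\<in>X. \<forall>x2\<in>X. \<forall>x3\<in>X. \<forall>w\<in>W.
     int N dvd x1 + x3 - 2 * x2 + w \<longrightarrow> x1 = x2 \<and> x3 = x2)"

lemma card_blocked:
  assumes N: "prime N" "N > 2" and fin: "finite X" "finite W"
  shows "card (blocked N W X) \<le> 4 * (card X)\<^sup>2 * card W"
proof -
  \<comment> \<open>Both coefficients of \<open>x\<close> in \<open>blocked\<close> are units modulo
    \<open>N\<close>. The coefficient 1 is written out there so that
    \<open>card_linear_cong_le_1\<close> fits all four congruences.\<close>
  have "\<not> int N dvd 1" "\<not> int N dvd 2"
    using N(2) by (auto dest: zdvd_imp_le)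
  then have le: "card {x \<in> Zmod N. [1 * x = b] (mod int N)} \<le> 1"
      "card {x \<in> Zmod N. [2 * x = b] (mod int N)} \<le> 1" for b
    using card_linear_cong_le_1[OF N(1)] by blast+
  have "card (blocked N W X) \<le> (\<Sum>p\<in>X \<times> X \<times> W. card (case p of (u, v, w) \<Rightarrow>
     {x \<in> Zmod N. [1 * x = 2 * u - v - w] (mod int N)} \<union> {x \<in> Zmod N. [2 * x = u + v + w] (mod int N)} \<union>
     ({x \<in> Zmod N. [1 * x = u + w] (mod int N)} \<union> {x \<in> Zmod N. [2 * x = 2 * u - w] (mod int N)})))"
    unfolding blocked_def using fin by (intro card_UN_le) simp
  also have "\<dots> \<le> (\<Sum>p\<in>X \<times> X \<times> W. (1 + 1) + (1 + 1))"
  proof (rule sum_mono)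
    fix p assume "p \<in> X \<times> X \<times> W"
    obtain u v w where p: "p = (u, v, w)" by (cases p)
    show "card (case p of (u, v, w) \<Rightarrow>
     {x \<in> Zmod N. [1 * x = 2 * u - v - w] (mod int N)} \<union> {x \<in> Zmod N. [2 * x = u + v + w] (mod int N)} \<union>
     ({x \<in> Zmod N. [1 * x = u + w] (mod int N)} \<union> {x \<in> Zmod N. [2 * x = 2 * u - w] (mod int N)}))
       \<le> (1 + 1) + (1 + 1)"
      unfolding p prod.case
      by (intro order_trans[OF card_Un_le] add_mono le)
  qed
  also have "\<dots> = 4 * (card X)\<^sup>2 * card W"
    by (simp add: card_cartesian_product power2_eq_square)
  finally show ?thesis .
qed

lemma diagonal_only_insert:
  assumes X: "diagonal_only N W X" and x: "x \<in> Zmod N" "x \<notin> blocked N W X"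
  shows "diagonal_only N W (insert x X)"
  unfolding diagonal_only_def
proof (intro ballI impI)
  fix x1 x2 x3 w
  assume mem: "x1 \<in> insert x X" "x2 \<in> insert x X" "x3 \<in> insert x X" and w: "w \<in> W"
    and dvd: "int N dvd x1 + x3 - 2 * x2 + w"
  have no1: "\<not> int N dvd x - (2 * u - v - w)" and no2: "\<not> int N dvd 2 * x - (u + v + w)"
    and no3: "\<not> int N dvd x - (u + w)" and no4: "\<not> int N dvd 2 * x - (2 * u - w)"
    if "u \<in> X" "v \<in> X" for u v
    using x that w unfolding blocked_def cong_iff_dvd_diff by auto
  have neg: "int N dvd - (x1 + x3 - 2 * x2 + w)"
    using dvd by (simp only: dvd_minus_iff)
  \<comment> \<open>The new point may be one end (cases 3 and 5), the middle (4), the middle and one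
    end (6 and 8) or both ends (7). If it fills all places the solution is diagonal; if none,
    \<open>X\<close> settles it.\<close>
  consider "x1 = x" "x2 = x" "x3 = x" | "x1 \<in> X" "x2 \<in> X" "x3 \<in> X"
    | "x1 = x" "x2 \<in> X" "x3 \<in> X" | "x1 \<in> X" "x2 = x" "x3 \<in> X" | "x1 \<in> X" "x2 \<in> X" "x3 = x"
    | "x1 = x" "x2 = x" "x3 \<in> X" | "x1 = x" "x2 \<in> X" "x3 = x" | "x1 \<in> X" "x2 = x" "x3 = x"
    using mem by blast
  then show "x1 = x2 \<and> x3 = x2"
  proof cases
    case 2
    then show ?thesis using X dvd w by (auto simp: diagonal_only_def)
  next
    case 3
    have eq: "x1 + x3 - 2 * x2 + w = x - (2 * x2 - x3 - w)" using 3 by simp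
    have "int N dvd x - (2 * x2 - x3 - w)"
      using dvd by (simp only: eq)
    then show ?thesis using no1[of x2 x3] 3 by blast
  next
    case 4
    have eq: "- (x1 + x3 - 2 * x2 + w) = 2 * x - (x1 + x3 + w)" using 4 by simp
    have "int N dvd 2 * x - (x1 + x3 + w)"
      using neg by (simp only: eq)
    then show ?thesis using no2[of x1 x3] 4 by blast
  next
    case 5
    have eq: "x1 + x3 - 2 * x2 + w = x - (2 * x2 - x1 - w)" using 5 by simp
    have "int N dvd x - (2 * x2 - x1 - w)"
      using dvd by (simp only: eq)
    then show ?thesis using no1[of x2 x1] 5 by blast
  next
    case 6
    have eq: "- (x1 + x3 - 2 * x2 + w) = x - (x3 + w)" using 6 by simp
    have "int N dvd x - (x3 + w)"
      using neg by (simp only: eq)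
    then show ?thesis using no3[of x3 x3] 6 by blast
  next
    case 7
    have eq: "x1 + x3 - 2 * x2 + w = 2 * x - (2 * x2 - w)" using 7 by simp
    have "int N dvd 2 * x - (2 * x2 - w)"
      using dvd by (simp only: eq)
    then show ?thesis using no4[of x2 x2] 7 by blast
  next
    case 8
    have eq: "- (x1 + x3 - 2 * x2 + w) = x - (x1 + w)" using 8 by simp
    have "int N dvd x - (x1 + w)"
      using neg by (simp only: eq)
    then show ?thesis using no3[of x1 x1] 8 by blast
  qed simp
qed

text \<open>Each \<open>T K\<close> keeps at least \<open>\<tau> / 2\<close> points outside
  \<open>F\<close>, so averaging over at most \<open>N\<close> points finds one that lies in the
  required share of the sets.\<close>

lemma exists_often_hit_point:
  fixes B :: "'a set" and T :: "'a \<Rightarrow> int set" and \<tau> :: real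
  assumes N: "N > 0" and B: "finite B" and T: "\<And>K. K \<in> B \<Longrightarrow> T K \<subseteq> Zmod N"
    and large: "\<And>K. K \<in> B \<Longrightarrow> \<tau> \<le> card (T K)" and F: "finite F" "2 * real (card F) \<le> \<tau>"
    and ne: "card F < N"
  shows "\<exists>x\<in>Zmod N - F. \<tau> / (2 * N) * card B \<le> card {K \<in> B. x \<in> T K}"
proof (rule ccontr)
  assume "\<not> ?thesis"
  then have few: "real (card {K \<in> B. x \<in> T K}) < \<tau> / (2 * N) * card B" if "x \<in> Zmod N - F" for x
    using that by (auto simp: not_le)
  have "Zmod N - F \<noteq> {}"
    using ne F(1) card_mono[of F "Zmod N"] by auto
  have \<tau>: "\<tau> \<ge> 0" using F(2) by linarith
  have half: "\<tau> / 2 \<le> card (T K - F)" if "K \<in> B" for K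
  proof -
    have "card (T K) \<le> card (T K - F) + card F"
      using F(1) diff_card_le_card_Diff[of F "T K"] by linarith
    then have "real (card (T K)) \<le> real (card (T K - F) + card F)" by (rule of_nat_mono)
    then show ?thesis using large[OF that] F(2) by simp
  qed
  have "real (card B) * (\<tau> / 2) = (\<Sum>K\<in>B. \<tau> / 2)" by simp
  also have "\<dots> \<le> (\<Sum>K\<in>B. real (card (T K - F)))"
    by (intro sum_mono half)
  also have "\<dots> = (\<Sum>K\<in>B. \<Sum>x\<in>Zmod N - F. if x \<in> T K then 1 else 0)"
  proof (rule sum.cong[OF refl])
    fix K assume "K \<in> B"
    then have "T K - F = {x \<in> Zmod N - F. x \<in> T K}" using T by auto
    then show "real (card (T K - F)) = (\<Sum>x\<in>Zmod N - F. if x \<in> T K then 1 else 0)"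
      by (simp add: sum.If_cases Int_def)
  qed
  also have "\<dots> = (\<Sum>x\<in>Zmod N - F. \<Sum>K\<in>B. if x \<in> T K then 1 else 0)"
    by (rule sum.swap)
  also have "\<dots> = (\<Sum>x\<in>Zmod N - F. real (card {K \<in> B. x \<in> T K}))"
    using B by (simp add: sum.If_cases Int_def)
  also have "\<dots> < (\<Sum>x\<in>Zmod N - F. \<tau> / (2 * N) * card B)"
    using few \<open>Zmod N - F \<noteq> {}\<close> by (intro sum_strict_mono) auto
  also have "\<dots> = real (card (Zmod N - F)) * (\<tau> / (2 * N) * card B)" by simp
  also have "\<dots> \<le> real N * (\<tau> / (2 * N) * card B)"
    using card_mono[of "Zmod N" "Zmod N - F"] \<tau> by (intro mult_right_mono) auto
  also have "\<dots> = real (card B) * (\<tau> / 2)" using N by simp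
  finally show False by simp
qed

text \<open>With at most \<open>n\<close> points in \<open>X\<close> the blocked residues number at
  most \<open>\<tau> / 2\<close>, so at each step some free point hits a share
  \<open>\<tau> / (2 * N)\<close> of the sets still unhit.\<close>

lemma exists_greedy_hitting_set:
  fixes B :: "'a set" and T :: "'a \<Rightarrow> int set" and \<tau> :: real
  assumes N: "prime N" "N > 2" and B: "finite B" and W: "finite W"
    and T: "\<And>K. K \<in> B \<Longrightarrow> T K \<subseteq> Zmod N" and large: "\<And>K. K \<in> B \<Longrightarrow> \<tau> \<le> card (T K)"
    and \<tau>: "\<tau> \<le> N" and n: "8 * (real n)\<^sup>2 * card W \<le> \<tau>" and j: "j \<le> n"
  shows "\<exists>X. X \<subseteq> Zmod N \<and> card X \<le> j \<and> diagonal_only N W X \<and>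
    real (card {K \<in> B. X \<inter> T K = {}}) \<le> (1 - \<tau> / (2 * N)) ^ j * card B"
  using j
proof (induction j)
  case 0
  show ?case by (intro exI[of _ "{}"]) (simp add: diagonal_only_def)
next
  case (Suc j)
  then obtain X where X: "X \<subseteq> Zmod N" "card X \<le> j" "diagonal_only N W X"
    and unhit: "real (card {K \<in> B. X \<inter> T K = {}}) \<le> (1 - \<tau> / (2 * N)) ^ j * card B"
    by (meson Suc_leD)
  define U where "U = {K \<in> B. X \<inter> T K = {}}"
  have finX: "finite X" using X(1) finite_subset finite_Zmod by blast
  define F where "F = blocked N W X"
  have finF: "finite F"
    by (rule finite_subset[of _ "Zmod N"]) (auto simp: F_def blocked_def)
  have "card F \<le> 4 * (card X)\<^sup>2 * card W"
    unfolding F_def by (rule card_blocked[OF N finX W])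
  also have "\<dots> \<le> 4 * n\<^sup>2 * card W"
    using X(2) Suc.prems by (intro mult_le_mono1 mult_le_mono2 power_mono) auto
  finally have "real (card F) \<le> real (4 * n\<^sup>2 * card W)" by (rule of_nat_mono)
  then have F: "2 * real (card F) \<le> \<tau>" using n by simp
  then have "2 * real (card F) \<le> real N" using \<tau> by linarith
  then have F_lt: "card F < N" using N(2) by simp
  obtain x where x: "x \<in> Zmod N - F" and hit: "\<tau> / (2 * N) * card U \<le> card {K \<in> U. x \<in> T K}"
    using exists_often_hit_point[of N U T \<tau> F] N(2) B T large finF F F_lt by (auto simp: U_def)
  have finU: "finite U" using B by (simp add: U_def)
  have "{K \<in> B. insert x X \<inter> T K = {}} = U - {K \<in> U. x \<in> T K}"
    by (auto simp: U_def)
  then have "card {K \<in> B. insert x X \<inter> T K = {}} = card U - card {K \<in> U. x \<in> T K}"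
    using finU by (simp add: card_Diff_subset)
  moreover have "card {K \<in> U. x \<in> T K} \<le> card U"
    using finU by (intro card_mono) auto
  ultimately have "real (card {K \<in> B. insert x X \<inter> T K = {}}) \<le> (1 - \<tau> / (2 * N)) * card U"
    using hit by (simp add: left_diff_distrib)
  also have "\<dots> \<le> (1 - \<tau> / (2 * N)) * ((1 - \<tau> / (2 * N)) ^ j * card B)"
    using unhit \<tau> N(2) by (intro mult_left_mono) (auto simp: U_def field_simps)
  finally have "real (card {K \<in> B. insert x X \<inter> T K = {}}) \<le> (1 - \<tau> / (2 * N)) ^ Suc j * card B"
    by (simp only: power_Suc mult.assoc)
  moreover have "diagonal_only N W (insert x X)"
    using X(3) x by (intro diagonal_only_insert) (auto simp: F_def)
  moreover have "card (insert x X) \<le> Suc j"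
    using X(2) finX by (simp add: card_insert_if)
  moreover have "insert x X \<subseteq> Zmod N" using X(1) x by simp
  ultimately show ?case by (intro exI[of _ "insert x X"] conjI)
qed

section \<open>Sumsets and progressions modulo N\<close>

definition sumset_mod :: "nat \<Rightarrow> int set \<Rightarrow> int set \<Rightarrow> int set" where
  "sumset_mod N X Y = (\<lambda>(x, y). (x + y) mod int N) ` (X \<times> Y)"

text \<open>The second difference of the \<open>Y\<close>-parts is an element \<open>w\<close> of
  \<open>second_diffs N Y\<close>, so \<open>diagonal_only\<close> puts all three terms into one
  translate of \<open>Y\<close>, where the progression is trivial.\<close>

lemma ap3_free_mod_sumset:
  assumes Y: "ap3_free_mod N Y" and X: "diagonal_only N (second_diffs N Y) X"
  shows "ap3_free_mod N (sumset_mod N X Y)"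
  unfolding ap3_free_mod_def
proof (intro ballI impI)
  fix p q s
  assume mem: "p \<in> sumset_mod N X Y" "q \<in> sumset_mod N X Y" "s \<in> sumset_mod N X Y"
    and cong: "[p + s = 2 * q] (mod int N)"
  obtain x1 y1 where p: "p = (x1 + y1) mod int N" "x1 \<in> X" "y1 \<in> Y"
    using mem(1) by (auto simp: sumset_mod_def)
  obtain x2 y2 where q: "q = (x2 + y2) mod int N" "x2 \<in> X" "y2 \<in> Y"
    using mem(2) by (auto simp: sumset_mod_def)
  obtain x3 y3 where s: "s = (x3 + y3) mod int N" "x3 \<in> X" "y3 \<in> Y"
    using mem(3) by (auto simp: sumset_mod_def)
  define w where "w = (y1 + y3 - 2 * y2) mod int N"
  have w: "w \<in> second_diffs N Y"
    unfolding w_def using p q s by (intro second_diffsI)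
  have "[(x1 + y1) + (x3 + y3) = p + s] (mod int N)"
    unfolding p(1) s(1) by (intro cong_add) (simp_all add: cong_def)
  moreover have "[2 * q = 2 * (x2 + y2)] (mod int N)"
    unfolding q(1) by (intro cong_mult cong_refl) (simp add: cong_def)
  ultimately have sum: "[(x1 + y1) + (x3 + y3) = 2 * (x2 + y2)] (mod int N)"
    using cong cong_trans by blast
  have "[x1 + x3 - 2 * x2 + w = x1 + x3 - 2 * x2 + (y1 + y3 - 2 * y2)] (mod int N)"
    unfolding w_def by (intro cong_add cong_refl) (simp add: cong_def)
  also have "x1 + x3 - 2 * x2 + (y1 + y3 - 2 * y2) = (x1 + y1) + (x3 + y3) - 2 * (x2 + y2)"
    by simp
  also have "[\<dots> = 0] (mod int N)"
    using sum by (simp only: cong_iff_dvd_diff diff_zero)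
  finally have "int N dvd x1 + x3 - 2 * x2 + w"
    by (simp add: cong_0_iff)
  then have x: "x1 = x2" "x3 = x2"
    using X w p q s by (auto simp: diagonal_only_def)
  have "[y1 + y3 = 2 * y2] (mod int N)"
    using sum unfolding x cong_iff_dvd_diff by (simp add: algebra_simps)
  then have "y1 = y2" using Y p q s by (auto simp: ap3_free_mod_def)
  then show "p = q" using x p q by simp
qed

lemma sumset_mod_meets:
  assumes "X \<inter> diffset N K Y \<noteq> {}" "K \<subseteq> Zmod N"
  shows "sumset_mod N X Y \<inter> K \<noteq> {}"
proof -
  obtain t y where ty: "t \<in> K" "y \<in> Y" "(t - y) mod int N \<in> X"
    using assms(1) by (auto simp: diffset_def)
  have "((t - y) mod int N + y) mod int N = t mod int N" by (simp add: mod_add_left_eq)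
  also have "\<dots> = t" using ty(1) assms(2) by (auto simp: Zmod_def)
  finally have "t \<in> sumset_mod N X Y"
    unfolding sumset_mod_def using ty by (force simp: image_iff)
  then show ?thesis using ty(1) by blast
qed

text \<open>The first three terms of a progression suffice: \<open>a 1 = a 2\<close> contradicts a
  nonzero difference \<open>d\<close>.\<close>

lemma not_contains_AP_mod:
  assumes I: "ap3_free_mod N I" and r: "r \<ge> 3"
  shows "\<not> contains_AP_mod N r I"
proof
  assume "contains_AP_mod N r I"
  then obtain a :: "nat \<Rightarrow> int" and d where sub: "a ` {1..r} \<subseteq> I" and d: "\<not> [d = 0] (mod int N)"
    and ap: "\<And>i. i \<in> {1..r} \<Longrightarrow> [a i = a 1 + (int i - 1) * d] (mod int N)"
    unfolding contains_AP_mod_def is_AP_mod_def by blast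
  have 2: "[a 2 = a 1 + d] (mod int N)" using ap[of 2] r by simp
  have 3: "[a 3 = a 1 + 2 * d] (mod int N)" using ap[of 3] r by simp
  have mem: "a 1 \<in> I" "a 2 \<in> I" "a 3 \<in> I" using sub r by auto
  have "[a 1 + a 3 = a 1 + (a 1 + 2 * d)] (mod int N)"
    using 3 by (intro cong_add cong_refl)
  also have "a 1 + (a 1 + 2 * d) = 2 * (a 1 + d)" by simp
  also have "[2 * (a 1 + d) = 2 * a 2] (mod int N)"
    using 2 by (intro cong_mult cong_refl) (rule cong_sym)
  finally have "a 1 = a 2" using I mem by (auto simp: ap3_free_mod_def)
  then have "[0 = d] (mod int N)" using 2 by (simp add: cong_iff_dvd_diff)
  then show False using d by (simp add: cong_sym)
qed

subsection \<open>Choice of parameters\<close>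

text \<open>The number \<open>D\<close> of summands is taken so large that \<open>k * L ^ D\<close>
  is \<open>N\<close> up to a constant factor. The moment bound then applies to every
  \<open>K\<close>: after a \<open>lam\<close>-th root the number of sets costs only
  \<open>N powr \<gamma>\<close>, because \<open>c \<le> \<gamma> * lam\<close>. The powers
  \<open>4 ^ D\<close> and \<open>(L ^ D) powr \<epsilon>\<close> cost
  \<open>N powr \<epsilon>\<close> each.\<close>

lemma exists_spreading_sumset:
  fixes \<epsilon> \<gamma> \<kappa> c :: real and A :: "int set" and L lam k N :: nat
  assumes N: "prime N" and A: "A \<subseteq> {0..<int L}" and L: "L \<ge> 1"
    and A_free: "ap3_free A"
    and A_large: "4 * real L powr (1 - \<epsilon>) \<le> card A" and \<epsilon>: "0 < \<epsilon>" "\<epsilon> \<le> \<kappa>" "\<kappa> \<le> 1"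
    and lam: "lam \<ge> 1" "c \<le> \<gamma> * lam"
    and B: "\<And>K. K \<in> B \<Longrightarrow> K \<subseteq> Zmod N \<and> card K = k" and B_card: "real (card B) \<le> real N powr c"
    and k: "real N powr \<kappa> \<le> k" and LN: "2 * L \<le> N" and kN: "k * (2 * L ^ lam) \<le> N"
  shows "\<exists>Y. Y \<subseteq> Zmod N \<and> ap3_free_mod N Y \<and>
    real (card (second_diffs N Y)) \<le> real N powr (1 - \<kappa> + \<epsilon>) \<and>
    (\<forall>K\<in>B. real N powr (1 - \<gamma> - 2 * \<epsilon>) / (2 * real L ^ lam * real L) \<le> card (diffset N K Y))"
proof -
  define a where "a = card A"
  define n where "n = real N"
  have N1: "n \<ge> 1" using prime_ge_1_nat[OF N] by (simp add: n_def)
  have finA: "finite A" using A finite_subset by blast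
  have aL: "a \<le> L" using card_mono[OF _ A] by (simp add: a_def)
  have L_powr: "real L powr 1 = real L" using L by simp
  have "4 * real L powr (1 - \<epsilon>) \<le> real L powr 1"
    using A_large aL L unfolding a_def L_powr by linarith
  also have "real L powr 1 = real L powr \<epsilon> * real L powr (1 - \<epsilon>)"
    using L by (simp flip: powr_add)
  \<comment> \<open>Comparing \<open>card A \<le> L\<close> with \<open>A_large\<close> shows that
    constants \<open>4 ^ D\<close> are absorbed by \<open>(L ^ D) powr \<epsilon>\<close>.\<close>
  finally have L_eps: "4 \<le> real L powr \<epsilon>" using L by simp
  have L2: "L \<ge> 2"
  proof (rule ccontr)
    assume "\<not> L \<ge> 2"
    then have "L = 1" using L by simp
    then show False using L_eps by simp
  qed
  have "real L powr (1 - \<epsilon>) > 0" using L by simp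
  then have "real a > 0" using A_large unfolding a_def by linarith
  then have a0: "a > 0" by simp
  have A_ne: "A \<noteq> {}" using a0 by (auto simp: a_def)
  have k0: "k > 0"
  proof -
    have "0 < real N powr \<kappa>" using N1 by (simp add: n_def)
    then have "real k > 0" using k by linarith
    then show ?thesis by simp
  qed
  \<comment> \<open>The factor \<open>2 * L ^ lam\<close> is the room that the hypothesis
    \<open>small\<close> of \<open>exists_iterated_sumset\<close> asks for; see
    \<open>D2\<close>.\<close>
  define M where "M = 2 * L ^ lam"
  have M: "M \<ge> 1" using L by (simp add: M_def Suc_le_eq)
  have kM: "k * M > 0" using k0 M by simp
  have "N div (k * M) \<ge> 1"
    using kN kM by (simp add: M_def Suc_le_eq div_greater_zero_iff)
  \<comment> \<open>\<open>D\<close> is maximal with \<open>L ^ D * (k * M) \<le> N\<close>;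
    maximality bounds \<open>k * L ^ D\<close> from below by \<open>N / (M * L)\<close>.\<close>
  then obtain D where D: "L ^ D \<le> N div (k * M)" "N div (k * M) < L ^ (D + 1)"
    using ex_power_ivl1[OF L2] by blast
  have D_le: "L ^ D * (k * M) \<le> N"
    using D(1) kM by (simp add: less_eq_div_iff_mult_less_eq)
  have "N < L ^ (D + 1) * (k * M)"
    using D(2) kM by (simp add: div_less_iff_less_mult)
  then have "n < real (L ^ (D + 1) * (k * M))" unfolding n_def by (simp only: of_nat_less_iff)
  then have D_gt: "n < real k * real L ^ D * (real M * real L)" by (simp add: mult_ac)
  have LD_N: "real L ^ D \<le> n"
  proof -
    have "L ^ D * 1 \<le> L ^ D * (k * M)" using kM by (intro mult_le_mono2) simp
    then have "L ^ D \<le> N" using D_le by linarith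
    then show ?thesis unfolding n_def by (metis of_nat_le_iff of_nat_power)
  qed
  have LD_pow: "real (L ^ D) powr x = (real L powr x) ^ D" for x
  proof -
    have "real (L ^ D) = real L powr real D" using L by (simp add: powr_realpow)
    then have "real (L ^ D) powr x = real L powr (real D * x)" by (simp only: powr_powr)
    then show ?thesis using L by (simp add: powr_power)
  qed
  have four: "4 ^ D \<le> n powr \<epsilon>"
  proof -
    have "4 ^ D \<le> (real L powr \<epsilon>) ^ D" using L_eps by (intro power_mono) auto
    also have "\<dots> = real (L ^ D) powr \<epsilon>" by (simp only: LD_pow)
    also have "\<dots> \<le> n powr \<epsilon>" using LD_N \<epsilon> by (intro powr_mono2) auto
    finally show ?thesis .
  qed
  have LD: "2 * real L ^ D \<le> n powr (1 - \<kappa>)"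
  proof -
    have "M \<ge> 2" using L by (simp add: M_def Suc_le_eq)
    then have "2 * n powr \<kappa> \<le> real M * real k"
      using k by (intro mult_mono) (auto simp: n_def)
    then have "real L ^ D * (2 * n powr \<kappa>) \<le> real L ^ D * (real M * real k)"
      by (rule mult_left_mono) simp
    then have "2 * real L ^ D * n powr \<kappa> \<le> real L ^ D * (real k * real M)"
      by (simp only: mult_ac)
    also have "\<dots> = real (L ^ D * (k * M))" by simp
    also have "\<dots> \<le> n" unfolding n_def using D_le by (rule of_nat_mono)
    also have "\<dots> = n powr (1 - \<kappa>) * n powr \<kappa>" using N1 by (simp flip: powr_add)
    finally show ?thesis using N1 by simp
  qed
  have fourLD: "2 * (4 * real L) ^ D \<le> n powr (1 - \<kappa> + \<epsilon>)"
  proof -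
    have "2 * (4 * real L) ^ D = 4 ^ D * (2 * real L ^ D)" by (simp add: power_mult_distrib)
    also have "\<dots> \<le> n powr \<epsilon> * n powr (1 - \<kappa>)"
      using four LD by (intro mult_mono) auto
    finally show ?thesis by (simp add: powr_add mult.commute)
  qed
  also have "\<dots> \<le> n powr 1" using N1 \<epsilon> by (intro powr_mono) auto
  finally have "real (2 * (4 * L) ^ D) \<le> real N" using N1 by (simp add: n_def)
  then have D1: "2 * (4 * L) ^ D \<le> N" by (simp only: of_nat_le_iff)
  have D2: "2 * real k * real (card A) ^ D \<le> real N * (2 / real (card A)) ^ lam"
  proof -
    have "2 * real k * real a ^ D * (real a / 2) ^ lam \<le> 2 * real k * real L ^ D * real L ^ lam"
      using aL by (intro mult_mono power_mono) auto
    also have "\<dots> = real (L ^ D * (k * M))" by (simp add: M_def)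
    also have "\<dots> \<le> real N" using D_le by (rule of_nat_mono)
    finally have "2 * real k * real a ^ D * (real a / 2) ^ lam * (2 / real a) ^ lam \<le> real N * (2 / real a) ^ lam"
      by (intro mult_right_mono) auto
    moreover have "(real a / 2) ^ lam * (2 / real a) ^ lam = 1"
      using a0 by (simp flip: power_mult_distrib)
    ultimately show ?thesis by (simp add: a_def mult.assoc)
  qed
  have L0: "L > 0" using L by simp
  obtain Y where Y_props: "Y \<subseteq> Zmod N \<and> Y \<noteq> {} \<and> ap3_free_mod N Y \<and>
    card (second_diffs N Y) \<le> (4 * L) ^ D \<and> card Y \<le> card A ^ D \<and>
    (\<Sum>K\<in>B. 1 / real (card (diffset N K Y)) ^ lam)
       \<le> (4 * (2 / real (card A)) ^ lam) ^ D * (real (card B) / real k ^ lam)"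
    using exists_iterated_sumset[where B = B, OF N LN L0 A A_ne A_free B k0 D1 D2 order_refl] by (rule exE)
  then have Y: "Y \<subseteq> Zmod N" "ap3_free_mod N Y" "card (second_diffs N Y) \<le> (4 * L) ^ D" "Y \<noteq> {}"
    by simp_all
  have sum: "(\<Sum>K\<in>B. 1 / real (card (diffset N K Y)) ^ lam)
       \<le> (4 * (2 / real (card A)) ^ lam) ^ D * (real (card B) / real k ^ lam)"
    using Y_props by (elim conjE)
  have "real (card (second_diffs N Y)) \<le> real ((4 * L) ^ D)" using Y(3) by (rule of_nat_mono)
  also have "\<dots> \<le> 2 * (4 * real L) ^ D" by simp
  also note fourLD
  finally have W: "real (card (second_diffs N Y)) \<le> n powr (1 - \<kappa> + \<epsilon>)" .
  have "n powr (1 - \<gamma> - 2 * \<epsilon>) / (real M * real L) \<le> card (diffset N K Y)" if K: "K \<in> B" for K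
  proof -
    define t where "t = real (card (diffset N K Y))"
    have "B \<subseteq> Pow (Zmod N)" using B by auto
    then have finB: "finite B" by (rule finite_subset) simp
    have "diffset N K Y \<subseteq> Zmod N" using N by (intro diffset_subset) (simp add: prime_gt_0_nat)
    then have "finite (diffset N K Y)" by (rule finite_subset) simp
    moreover have "diffset N K Y \<noteq> {}"
      using B[OF K] k0 Y(4) by (auto simp: diffset_def)
    ultimately have t0: "t > 0" by (simp add: t_def card_gt_0_iff)
    \<comment> \<open>A single term is at most the whole sum, so the moment bound yields a lower
      bound for each \<open>K\<close>.\<close>
    have "1 / t ^ lam \<le> (\<Sum>K\<in>B. 1 / real (card (diffset N K Y)) ^ lam)"
      unfolding t_def using K finB by (intro member_le_sum) auto
    also note sum
    also have "(4 * (2 / real (card A)) ^ lam) ^ D * (real (card B) / real k ^ lam) =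
        4 ^ D * real (card B) / (real k * (real a / 2) ^ D) ^ lam"
      using a0 k0 by (simp add: a_def power_mult_distrib power_divide mult.commute flip: power_mult)
    finally have "1 / t ^ lam \<le> 4 ^ D * real (card B) / (real k * (real a / 2) ^ D) ^ lam" .
    then have "(real k * (real a / 2) ^ D) ^ lam \<le> 4 ^ D * real (card B) * t ^ lam"
      using t0 k0 a0 by (simp add: divide_simps mult_ac split: if_splits)
    also have "\<dots> \<le> (n powr (\<epsilon> + \<gamma>)) ^ lam * t ^ lam"
    proof -
      have "4 ^ D \<le> n powr (\<epsilon> * lam)"
      proof -
        have "n powr \<epsilon> \<le> n powr (\<epsilon> * lam)" using N1 \<epsilon> lam by (intro powr_mono) auto
        then show ?thesis using four by linarith
      qed
      moreover have "real (card B) \<le> n powr (\<gamma> * lam)"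
        using B_card powr_mono[OF lam(2), of n] N1 by (simp add: n_def)
      ultimately have "4 ^ D * real (card B) \<le> n powr (\<epsilon> * lam) * n powr (\<gamma> * lam)"
        by (intro mult_mono) auto
      also have "\<dots> = (n powr (\<epsilon> + \<gamma>)) ^ lam"
        using N1 by (simp add: powr_power algebra_simps flip: powr_add)
      finally show ?thesis using t0 by (intro mult_right_mono) auto
    qed
    also have "\<dots> = (n powr (\<epsilon> + \<gamma>) * t) ^ lam" by (simp add: power_mult_distrib)
    finally have le: "real k * (real a / 2) ^ D \<le> n powr (\<epsilon> + \<gamma>) * t"
      using t0 lam(1) power_mono_iff[of "real k * (real a / 2) ^ D" "n powr (\<epsilon> + \<gamma>) * t" lam] by simp
    \<comment> \<open>Replaces the size \<open>(a / 2) ^ D\<close> by \<open>L ^ D\<close>, at the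
      cost of the second factor \<open>n powr \<epsilon>\<close>.\<close>
    have "real L ^ D = real (L ^ D) powr \<epsilon> * real (L ^ D) powr (1 - \<epsilon>)"
      using L by (simp flip: powr_add)
    also have "\<dots> \<le> n powr \<epsilon> * (real a / 2) ^ D"
    proof (rule mult_mono)
      show "real (L ^ D) powr \<epsilon> \<le> n powr \<epsilon>" using LD_N \<epsilon> by (intro powr_mono2) auto
      have "real L powr (1 - \<epsilon>) \<ge> 0" by simp
      then have "real L powr (1 - \<epsilon>) \<le> real a / 2" using A_large unfolding a_def by linarith
      then show "real (L ^ D) powr (1 - \<epsilon>) \<le> (real a / 2) ^ D"
        unfolding LD_pow by (intro power_mono) auto
    qed auto
    finally have "real k * real L ^ D \<le> n powr \<epsilon> * (real k * (real a / 2) ^ D)"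
      using mult_left_mono[of "real L ^ D" "n powr \<epsilon> * (real a / 2) ^ D" "real k"] by (simp add: mult_ac)
    also have "\<dots> \<le> n powr \<epsilon> * (n powr (\<epsilon> + \<gamma>) * t)" using le by (intro mult_left_mono) auto
    also have "\<dots> = n powr (2 * \<epsilon> + \<gamma>) * t"
      by (simp add: algebra_simps flip: powr_add mult.assoc)
    finally have "real k * real L ^ D * (real M * real L) \<le> n powr (2 * \<epsilon> + \<gamma>) * t * (real M * real L)"
      by (intro mult_right_mono) auto
    then have "n \<le> n powr (2 * \<epsilon> + \<gamma>) * t * (real M * real L)" using D_gt by linarith
    moreover have "n powr (2 * \<epsilon> + \<gamma>) * n powr (1 - \<gamma> - 2 * \<epsilon>) = n" using N1 by (simp flip: powr_add)
    ultimately have "n powr (2 * \<epsilon> + \<gamma>) * n powr (1 - \<gamma> - 2 * \<epsilon>) \<le>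
        n powr (2 * \<epsilon> + \<gamma>) * (t * (real M * real L))"
      by (simp only: mult.assoc)
    then have "n powr (1 - \<gamma> - 2 * \<epsilon>) \<le> t * (real M * real L)"
      using N1 by simp
    then show ?thesis using M L by (simp add: t_def divide_le_eq)
  qed
  then show ?thesis using Y(1,2) W by (intro exI[of _ Y]) (auto simp: n_def M_def)
qed

lemma nat_ceiling_powr_le:
  assumes "x \<ge> 1" "a \<ge> 0"
  shows "real (nat \<lceil>x powr a\<rceil>) \<le> 2 * x powr a"
proof -
  have "1 \<le> x powr a" using assms by (rule ge_one_powr_ge_zero)
  then show ?thesis by linarith
qed

text \<open>Joins the spreading set \<open>Y\<close>, with \<open>\<epsilon> = \<gamma> / 2\<close>,
  to the greedy set \<open>X\<close>. \<open>M\<close> collects the constant factors, and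
  \<open>large\<close> lets small powers of \<open>N\<close> absorb them.\<close>

lemma exists_ap3_free_hitting_set_of_large_modulus:
  fixes \<kappa> c \<gamma> :: real and A :: "int set" and L lam N :: nat
  defines "M \<equiv> 2 * real L ^ lam * real L"
  assumes N: "prime N" and A: "A \<subseteq> {0..<int L}" and L: "L \<ge> 1"
    and A_free: "ap3_free A"
    and A_large: "4 * real L powr (1 - \<gamma> / 2) \<le> card A"
    and \<kappa>: "0 < \<kappa>" "\<kappa> \<le> 1 / 2" and \<gamma>: "\<gamma> = \<kappa> / 10" and c: "c > 0"
    and lam: "lam \<ge> 1" "c \<le> \<gamma> * lam"
    and B: "\<And>K. K \<in> B \<Longrightarrow> K \<subseteq> Zmod N \<and> real N powr \<kappa> \<le> card K"
    and B_card: "real (card B) \<le> real N powr c"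
    and large: "32 * M + 4 * c * M / \<gamma> + 4 \<le> real N powr (\<gamma> / 2)"
  shows "\<exists>I \<subseteq> Zmod N. ap3_free_mod N I \<and> (\<forall>K\<in>B. I \<inter> K \<noteq> {})"
proof -
  define n where "n = real N"
  have N1: "n \<ge> 1" using prime_ge_1_nat[OF N] by (simp add: n_def)
  have \<gamma>0: "0 < \<gamma>" using \<kappa> \<gamma> by simp
  have L1: "1 \<le> real L ^ lam" using L by simp
  have M_ge: "M \<ge> 2 * L" "M \<ge> 2 * real L ^ lam" "M \<ge> 2"
    using mult_mono[of 1 "real L ^ lam" "real L" "real L"]
      mult_mono[of "real L ^ lam" "real L ^ lam" 1 "real L"] mult_mono[of 1 "real L ^ lam" 1 "real L"] L L1
    by (auto simp: M_def)
  have cM: "4 * c * M / \<gamma> > 0" using c M_ge \<gamma>0 by simp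
  have big: "32 * M \<le> n powr (\<gamma> / 2)" "4 * c * M / \<gamma> < n powr (\<gamma> / 2)" "4 \<le> n powr (\<gamma> / 2)"
    using large cM M_ge by (simp_all add: n_def)
  have powr_le_n: "n powr (\<gamma> / 2) \<le> n"
  proof -
    have "\<gamma> / 2 \<le> 1" using \<gamma> \<kappa> by simp
    then show ?thesis using powr_mono[of "\<gamma> / 2" 1 n] N1 by simp
  qed
  \<comment> \<open>The sets are cut down to a common size \<open>k\<close>: equal sizes start the
    iteration, and the upper bound on \<open>k\<close> is needed for \<open>kN\<close>. Meeting
    \<open>f K\<close> implies meeting \<open>K\<close>.\<close>
  define k where "k = nat \<lceil>n powr \<kappa>\<rceil>"
  have k_ge: "n powr \<kappa> \<le> real k" unfolding k_def by (rule real_nat_ceiling_ge)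
  have k_le: "real k \<le> 2 * n powr \<kappa>" unfolding k_def using N1 \<kappa> by (intro nat_ceiling_powr_le) auto
  have "\<exists>K' \<subseteq> K. card K' = k" if "K \<in> B" for K
  proof -
    have "k \<le> card K" using B[OF that] by (simp add: k_def n_def nat_le_iff ceiling_le_iff)
    then show ?thesis by (metis obtain_subset_with_card_n)
  qed
  then obtain f where f: "\<And>K. K \<in> B \<Longrightarrow> f K \<subseteq> K \<and> card (f K) = k" by metis
  have "B \<subseteq> Pow (Zmod N)" using B by auto
  then have finB: "finite B" by (rule finite_subset) simp
  have LN: "2 * L \<le> N"
  proof -
    have "2 * real L \<le> n" using M_ge(1) M_ge(3) big(1) powr_le_n by simp
    then show ?thesis by (simp add: n_def)
  qed
  have kN: "k * (2 * L ^ lam) \<le> N"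
  proof -
    have "real (k * (2 * L ^ lam)) = real k * (2 * real L ^ lam)" by simp
    also have "\<dots> \<le> (2 * n powr \<kappa>) * M" using k_le M_ge by (intro mult_mono) auto
    also have "\<dots> = n powr \<kappa> * (2 * M)" by simp
    also have "\<dots> \<le> n powr \<kappa> * n powr (\<gamma> / 2)"
      using big(1) M_ge by (intro mult_left_mono) auto
    also have "\<dots> \<le> n powr 1"
      unfolding powr_add[symmetric] using N1 \<kappa> \<gamma> by (intro powr_mono) auto
    finally show ?thesis using N1 by (simp add: n_def del: of_nat_mult of_nat_power)
  qed
  have fB: "K \<subseteq> Zmod N \<and> card K = k" if "K \<in> f ` B" for K
    using that f B by blast
  have fB_card: "real (card (f ` B)) \<le> real N powr c"
    using card_image_le[OF finB, of f] B_card by linarith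
  have \<epsilon>: "0 < \<gamma> / 2" "\<gamma> / 2 \<le> \<kappa>" "\<kappa> \<le> 1" using \<gamma> \<kappa> by auto
  have exponent: "1 - \<gamma> - 2 * (\<gamma> / 2) = 1 - 2 * \<gamma>" by simp
  obtain Y where Y_props: "Y \<subseteq> Zmod N \<and> ap3_free_mod N Y \<and>
      real (card (second_diffs N Y)) \<le> n powr (1 - \<kappa> + \<gamma> / 2) \<and>
      (\<forall>K\<in>f ` B. n powr (1 - 2 * \<gamma>) / M \<le> card (diffset N K Y))"
    using exists_spreading_sumset[where B = "f ` B", OF N A L A_free A_large \<epsilon> lam fB fB_card
        k_ge[unfolded n_def] LN kN, folded n_def M_def, unfolded exponent]
    by (rule exE)
  then have Y: "Y \<subseteq> Zmod N" "ap3_free_mod N Y"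
    and W: "real (card (second_diffs N Y)) \<le> n powr (1 - \<kappa> + \<gamma> / 2)"
    and T: "\<And>K. K \<in> f ` B \<Longrightarrow> n powr (1 - 2 * \<gamma>) / M \<le> card (diffset N K Y)"
    by blast+
  define \<tau> where "\<tau> = n powr (1 - 2 * \<gamma>) / M"
  \<comment> \<open>The exponent must exceed \<open>2 * \<gamma>\<close>, so that
    \<open>s * \<tau> / N\<close> is a positive power of \<open>N\<close> up to constants. It must
    also keep \<open>s^2 * N powr (1 - \<kappa> + \<gamma> / 2)\<close> below \<open>\<tau>\<close>;
    with \<open>\<kappa> = 10 * \<gamma>\<close> the value \<open>3 * \<gamma>\<close> leaves a
    margin of \<open>3 * \<gamma> / 2\<close>.\<close>
  define s where "s = nat \<lceil>n powr (3 * \<gamma>)\<rceil>"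
  have s_ge: "n powr (3 * \<gamma>) \<le> real s" unfolding s_def by (rule real_nat_ceiling_ge)
  have s_le: "real s \<le> 2 * n powr (3 * \<gamma>)"
    unfolding s_def using N1 \<gamma>0 by (intro nat_ceiling_powr_le) auto
  have N2: "N > 2" using big(3) powr_le_n by (simp add: n_def)
  have \<tau>_pos: "\<tau> > 0" using N1 M_ge by (simp add: \<tau>_def)
  have \<tau>_le: "\<tau> \<le> real N"
  proof -
    have "\<tau> \<le> n powr (1 - 2 * \<gamma>) / 1"
      unfolding \<tau>_def using M_ge by (intro divide_left_mono) auto
    also have "\<dots> \<le> n" using powr_mono[of "1 - 2 * \<gamma>" 1 n] N1 \<gamma>0 by simp
    finally show ?thesis by (simp add: n_def)
  qed
  have blocked_small: "8 * (real s)\<^sup>2 * card (second_diffs N Y) \<le> \<tau>"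
  proof -
    have "8 * (real s)\<^sup>2 * card (second_diffs N Y) \<le> 8 * (2 * n powr (3 * \<gamma>))\<^sup>2 * n powr (1 - \<kappa> + \<gamma> / 2)"
      using s_le W by (intro mult_mono power_mono) auto
    also have "\<dots> = 32 * n powr (6 * \<gamma> + (1 - \<kappa> + \<gamma> / 2))"
      by (simp add: power2_eq_square algebra_simps flip: powr_add)
    also have "6 * \<gamma> + (1 - \<kappa> + \<gamma> / 2) = (1 - 2 * \<gamma>) + (- 3 * \<gamma> / 2)"
      using \<gamma> by (simp add: field_simps)
    also have "32 * n powr \<dots> = n powr (1 - 2 * \<gamma>) * (32 * n powr (- 3 * \<gamma> / 2))"
      by (simp only: powr_add mult_ac)
    also have "\<dots> \<le> n powr (1 - 2 * \<gamma>) * (1 / M)"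
    proof (rule mult_left_mono)
      have "32 * M * n powr (- 3 * \<gamma> / 2) \<le> n powr (\<gamma> / 2) * n powr (- 3 * \<gamma> / 2)"
        using big(1) by (rule mult_right_mono) simp
      also have "\<dots> = n powr (- \<gamma>)" by (simp flip: powr_add)
      also have "\<dots> \<le> n powr 0" using N1 \<gamma>0 by (intro powr_mono) auto
      finally show "32 * n powr (- 3 * \<gamma> / 2) \<le> 1 / M"
        using N1 M_ge by (simp add: field_simps)
    qed simp
    finally show ?thesis by (simp add: \<tau>_def)
  qed
  have finW: "finite (second_diffs N Y)" using Y(1) by (rule finite_second_diffs)
  have TZ: "diffset N K Y \<subseteq> Zmod N" for K using N2 by (simp add: diffset_subset)
  obtain X where X_props: "X \<subseteq> Zmod N \<and> card X \<le> s \<and> diagonal_only N (second_diffs N Y) X \<and>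
      real (card {K \<in> f ` B. X \<inter> diffset N K Y = {}}) \<le> (1 - \<tau> / (2 * N)) ^ s * card (f ` B)"
    using exists_greedy_hitting_set[where T = "\<lambda>K. diffset N K Y" and B = "f ` B", OF N N2
        finite_imageI[OF finB] finW TZ T[folded \<tau>_def] \<tau>_le blocked_small order_refl]
    by (rule exE)
  then have X: "X \<subseteq> Zmod N" "diagonal_only N (second_diffs N Y) X"
    and unhit: "real (card {K \<in> f ` B. X \<inter> diffset N K Y = {}}) \<le> (1 - \<tau> / (2 * N)) ^ s * card (f ` B)"
    by simp_all
  have "(1 - \<tau> / (2 * N)) ^ s * card (f ` B) < 1"
  proof -
    define u where "u = \<tau> / (2 * n)"
    have u: "u * real s \<ge> n powr \<gamma> / (2 * M)"
    proof -
      have "n powr (1 - 2 * \<gamma>) * n powr (3 * \<gamma>) = n powr (\<gamma> + 1)" by (simp flip: powr_add)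
      also have "\<dots> = n powr \<gamma> * n" using N1 by (simp add: powr_add)
      finally have "u * n powr (3 * \<gamma>) = n powr \<gamma> * n / (M * (2 * n))" by (simp add: u_def \<tau>_def)
      then have "n powr \<gamma> / (2 * M) = u * n powr (3 * \<gamma>)" using N1 by simp
      also have "\<dots> \<le> u * real s" using s_ge \<tau>_pos N1 by (intro mult_left_mono) (auto simp: u_def)
      finally show ?thesis .
    qed
    have "c * ln n < n powr \<gamma> / (2 * M)"
    proof -
      \<comment> \<open>Bounding the logarithm by \<open>n powr (\<gamma> / 2)\<close> is the source
        of the term \<open>4 * c * M / \<gamma>\<close> in \<open>large\<close>.\<close>
      have "c * ln n \<le> c * (n powr (\<gamma> / 2) / (\<gamma> / 2))"
        using c N1 \<gamma>0 by (intro mult_left_mono ln_powr_bound) auto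
      also have "\<dots> = (4 * c * M / \<gamma>) * n powr (\<gamma> / 2) / (2 * M)"
        using M_ge \<gamma>0 by (simp add: field_simps)
      also have "\<dots> < n powr (\<gamma> / 2) * n powr (\<gamma> / 2) / (2 * M)"
        using big M_ge N1 by (intro divide_strict_right_mono mult_strict_right_mono) auto
      also have "\<dots> = n powr \<gamma> / (2 * M)" by (simp flip: powr_add)
      finally show ?thesis .
    qed
    then have cu: "c * ln n < u * real s" using u by linarith
    have "1 - u \<ge> 0" using \<tau>_le N1 by (simp add: u_def n_def)
    moreover have "1 - u \<le> exp (- u)" using exp_ge_add_one_self[of "- u"] by simp
    ultimately have "(1 - u) ^ s \<le> exp (- u) ^ s" by (intro power_mono) auto
    also have "\<dots> = exp (- (u * real s))" by (simp add: mult.commute flip: exp_of_nat_mult)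
    finally have "(1 - u) ^ s * card (f ` B) \<le> exp (- (u * real s)) * n powr c"
      using fB_card by (intro mult_mono) (auto simp: n_def)
    also have "\<dots> = exp (c * ln n - u * real s)"
      using N1 by (simp add: powr_def mult_exp_exp)
    also have "\<dots> < 1" using cu by simp
    finally show ?thesis by (simp add: u_def n_def)
  qed
  then have "card {K \<in> f ` B. X \<inter> diffset N K Y = {}} = 0"
    using unhit by linarith
  then have all: "X \<inter> diffset N K Y \<noteq> {}" if "K \<in> f ` B" for K
    using that finB by auto
  show ?thesis
  proof (intro exI[of _ "sumset_mod N X Y"] conjI ballI)
    show "sumset_mod N X Y \<subseteq> Zmod N" using N2 by (auto simp: sumset_mod_def mod_in_Zmod)
    show "ap3_free_mod N (sumset_mod N X Y)" using Y(2) X(2) by (rule ap3_free_mod_sumset)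
    fix K assume K: "K \<in> B"
    have "sumset_mod N X Y \<inter> f K \<noteq> {}"
      using all[of "f K"] fB[of "f K"] K by (intro sumset_mod_meets) auto
    then show "sumset_mod N X Y \<inter> K \<noteq> {}" using f[OF K] by blast
  qed
qed

text \<open>\<open>\<gamma>\<close>, \<open>A\<close>, \<open>L\<close> and \<open>lam\<close> are
  fixed in this order from \<open>\<kappa>\<close> and \<open>c\<close> alone. Hence
  \<open>Q\<close>, the left side of the size condition on \<open>N\<close>, is a constant, and
  \<open>Q powr (2 / \<gamma>)\<close> is a threshold.\<close>

theorem exists_ap3_free_hitting_set:
  fixes \<kappa> c :: real
  assumes \<kappa>: "0 < \<kappa>" "\<kappa> \<le> 1 / 2" and c: "c > 0"
  shows "\<exists>N0. \<forall>N \<ge> N0. prime N \<longrightarrow> (\<forall>B. (\<forall>K\<in>B. K \<subseteq> Zmod N \<and> real N powr \<kappa> \<le> card K) \<and>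
    real (card B) \<le> real N powr c \<longrightarrow>
      (\<exists>I \<subseteq> Zmod N. ap3_free_mod N I \<and> (\<forall>K\<in>B. I \<inter> K \<noteq> {})))"
proof -
  define \<gamma> where "\<gamma> = \<kappa> / 10"
  have \<gamma>: "\<gamma> > 0" using \<kappa> by (simp add: \<gamma>_def)
  obtain L and A' :: "nat set" where L: "L \<ge> 1" and A': "A' \<subseteq> {..<L}"
    and free: "ap3_free A'"
    and large: "4 * real L powr (1 - \<gamma> / 2) \<le> card A'"
    using exists_large_ap3_free_set[of "\<gamma> / 2"] \<gamma> by auto
  define A where "A = int ` A'"
  have A: "A \<subseteq> {0..<int L}" using A' by (auto simp: A_def)
  have A_large: "4 * real L powr (1 - \<gamma> / 2) \<le> card A"
    using large by (simp add: A_def card_image)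
  have A_free: "ap3_free A"
    unfolding ap3_free_def
  proof (intro ballI impI)
    fix x y z assume xyz: "x \<in> A" "y \<in> A" "z \<in> A" "x + z = 2 * y"
    obtain x' y' z' where "x = int x'" "y = int y'" "z = int z'" "x' \<in> A'" "y' \<in> A'" "z' \<in> A'"
      using xyz(1-3) by (auto simp: A_def)
    moreover from this have "x' + z' = 2 * y'" using xyz(4) by linarith
    ultimately show "x = y" using free unfolding ap3_free_def by blast
  qed
  define lam where "lam = nat \<lceil>c / \<gamma>\<rceil> + 1"
  have lam: "lam \<ge> 1" "c \<le> \<gamma> * lam"
  proof -
    have "c / \<gamma> \<le> real lam" using real_nat_ceiling_ge[of "c / \<gamma>"] by (simp add: lam_def)
    then show "c \<le> \<gamma> * lam" using \<gamma> by (simp add: field_simps)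
  qed (simp add: lam_def)
  define M where "M = 2 * real L ^ lam * real L"
  define Q where "Q = 32 * M + 4 * c * M / \<gamma> + 4"
  have Q: "Q > 0" using c \<gamma> by (auto simp: Q_def M_def intro!: add_nonneg_pos add_nonneg_nonneg)
  show ?thesis
  proof (intro exI[of _ "nat \<lceil>Q powr (2 / \<gamma>)\<rceil>"] allI impI)
    fix N :: nat and B :: "int set set"
    assume N0: "nat \<lceil>Q powr (2 / \<gamma>)\<rceil> \<le> N" and N: "prime N"
      and B: "(\<forall>K\<in>B. K \<subseteq> Zmod N \<and> real N powr \<kappa> \<le> card K) \<and> real (card B) \<le> real N powr c"
    have "Q powr (2 / \<gamma>) \<le> real N" using N0 real_nat_ceiling_ge[of "Q powr (2 / \<gamma>)"] by linarith
    then have "(Q powr (2 / \<gamma>)) powr (\<gamma> / 2) \<le> real N powr (\<gamma> / 2)"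
      using \<gamma> by (intro powr_mono2) auto
    then have "Q \<le> real N powr (\<gamma> / 2)" using Q \<gamma> by (simp add: powr_powr)
    then have big: "32 * (2 * real L ^ lam * real L) + 4 * c * (2 * real L ^ lam * real L) / \<gamma> + 4
        \<le> real N powr (\<gamma> / 2)"
      by (simp only: Q_def M_def)
    show "\<exists>I \<subseteq> Zmod N. ap3_free_mod N I \<and> (\<forall>K\<in>B. I \<inter> K \<noteq> {})"
      using B by (intro exists_ap3_free_hitting_set_of_large_modulus[where B = B, OF N A L A_free A_large \<kappa> \<gamma>_def c lam _ _ big]) auto
  qed
qed

section \<open>Comparison with the prescribed set size\<close>

text \<open>The logarithms combine to a power of \<open>ln N\<close> with nonnegative exponent, and
  \<open>ln N \<ge> 1\<close> because \<open>N \<ge> 3\<close> exceeds e.\<close>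

lemma kN_ge:
  assumes "r \<ge> 3" "N \<ge> 3"
  shows "real N powr (1 / (real r - 1)) \<le> real (kN r 1 N)"
proof -
  define \<kappa> where "\<kappa> = 1 / (real r - 1)"
  have \<kappa>: "0 < \<kappa>" "\<kappa> \<le> 1" using assms by (auto simp: \<kappa>_def field_simps)
  have "exp 1 \<le> real N" using exp_le assms(2) by (simp add: le_trans)
  then have ln1: "1 \<le> ln (real N)" using assms(2) by (simp add: ln_ge_iff)
  have "ln (real N) powr \<kappa> \<le> ln (real N)" using powr_mono[of \<kappa> 1 "ln (real N)"] ln1 \<kappa> by simp
  then have "real N powr \<kappa> * 1 \<le> real N powr \<kappa> * (ln (real N) / ln (real N) powr \<kappa>)"
    using ln1 by (intro mult_left_mono) (auto simp: field_simps)
  also have "\<dots> = 1 * (real N / ln (real N)) powr \<kappa> * ln (real N)"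
    using ln1 by (simp add: powr_divide)
  also have "\<dots> \<le> real (kN r 1 N)" unfolding kN_def \<kappa>_def by (rule real_nat_ceiling_ge)
  finally show ?thesis by (simp add: \<kappa>_def)
qed

theorem theorem6:
  fixes r :: nat and c :: real
  assumes "r \<ge> 3" and "c > 0"
  shows "\<exists>(C::real) (N0::nat). C > 0 \<and> N0 > 0 \<and>
    (\<forall>N::nat. prime N \<and> N \<ge> N0 \<longrightarrow>
      (\<forall>\<B> :: int set set.
         (\<forall>K\<in>\<B>. K \<subseteq> Zmod N \<and> card K = kN r C N) \<and>
         real (card \<B>) \<le> real N powr c \<longrightarrow>
         (\<exists>I \<subseteq> Zmod N. \<not> contains_AP_mod N r I \<and>
            (\<forall>K\<in>\<B>. card (I \<inter> K) \<ge> 1))))"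
proof -
  have "0 < 1 / (real r - 1)" "1 / (real r - 1) \<le> 1 / 2"
    using assms(1) by (auto simp: field_simps)
  from exists_ap3_free_hitting_set[OF this assms(2)] obtain N0 where
    N0: "\<forall>N \<ge> N0. prime N \<longrightarrow> (\<forall>B. (\<forall>K\<in>B. K \<subseteq> Zmod N \<and> real N powr (1 / (real r - 1)) \<le> card K) \<and>
      real (card B) \<le> real N powr c \<longrightarrow>
        (\<exists>I \<subseteq> Zmod N. ap3_free_mod N I \<and> (\<forall>K\<in>B. I \<inter> K \<noteq> {})))"
    by (rule exE)
  show ?thesis
  \<comment> \<open>\<open>C = 1\<close> suffices, as only a lower bound on the set size is used;
    the summand 3 serves \<open>kN_ge\<close> and makes the threshold positive.\<close>
  proof (rule exI[of _ 1], rule exI[of _ "N0 + 3"], intro conjI allI impI)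
    fix N :: nat and \<B> :: "int set set"
    assume N: "prime N \<and> N \<ge> N0 + 3"
      and \<B>: "(\<forall>K\<in>\<B>. K \<subseteq> Zmod N \<and> card K = kN r 1 N) \<and> real (card \<B>) \<le> real N powr c"
    have "\<forall>K\<in>\<B>. K \<subseteq> Zmod N \<and> real N powr (1 / (real r - 1)) \<le> card K"
      using \<B> kN_ge[OF assms(1), of N] N by auto
    then have "\<exists>I \<subseteq> Zmod N. ap3_free_mod N I \<and> (\<forall>K\<in>\<B>. I \<inter> K \<noteq> {})"
      using N0[THEN spec, of N] N \<B> by simp
    then obtain I where I: "I \<subseteq> Zmod N" "ap3_free_mod N I" "\<forall>K\<in>\<B>. I \<inter> K \<noteq> {}"
      by blast
    have "finite I" using I(1) finite_subset finite_Zmod by blast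
    then have "card (I \<inter> K) \<ge> 1" if "K \<in> \<B>" for K
      using I(3) that by (simp add: Suc_le_eq card_gt_0_iff)
    then show "\<exists>I \<subseteq> Zmod N. \<not> contains_AP_mod N r I \<and> (\<forall>K\<in>\<B>. card (I \<inter> K) \<ge> 1)"
      using I not_contains_AP_mod[OF I(2) assms(1)] by blast
  qed auto
qed

end
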